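(* Let $P$ be an admissible distribution on $[0,1]^n$ and let $\eta\in(1,4/3)$. Under the egalitarian welfare metric, the policy $\mathsf{BIRT}_\eta$ (Backward Infrequent Re-solving with Thresholding) satisfies $$\mathcal{R}_T(\mathsf{BIRT}_\eta)=\mathbb{E}\left[\mathsf{OPT}-\mathsf{ALG}(\mathsf{BIRT}_\eta)\right]=O(1)\quad\text{as a function of }T,$$ i.e. there is a constant $C<\infty$, determined solely by $P$ and $\eta$, such that $\mathcal{R}_T(\mathsf{BIRT}_\eta)\le C$ for all integers $T\ge 3$.
   Context: There are $n$ agents and $T$ periods. $\Delta_n=\{x\in\mathbb{R}_+^n:\sum_i x^i=1\}$. A distribution $P$ on $[0,1]^n$ is admissible if it has finite support: $P\{b=\beta_\ell\}=p_\ell>0$ for $\ell\in[L]=\{1,\dots,L\}$, with distinct $\beta_\ell\in[0,1]^n$ and $\sum_\ell p_\ell=1$. The marginal utility vectors $b_1,\dots,b_T$ are i.i.d. with law $P$. Allocations $x_1,\dots,x_T\in\Delta_n$ give agent $i$ cumulative utility $B_t^i=\sum_{s=1}^t b_s^i x_s^i$ by time $t$ (with $B_0^i=0$). The egalitarian welfare is $w(B)=\min_{i\in[n]}B^i$. Hindsight optimum: $\mathsf{OPT}=\max\left\{\min_{i}\sum_{t=1}^T b_t^i x_t^i: x_1,\dots,x_T\in\Delta_n\right\}$, computed for the realized sequence. For a policy $\pi$, $\mathsf{ALG}(\pi)=\min_i B_T^i$ under the allocations made by $\pi$. Policy $\mathsf{BIRT}_\eta$ (for $T\ge3$). Let $K=\lceil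 \log\log T/\log\eta\rceil$; $t_0^*=0$, $t_k^*=T-\lfloor\exp(\eta^{K-k})\rfloor$ for $k=1,\dots,K$, and $t_{K+1}^*=T$. Let $\gamma_k=\dfrac{T-t_{k+1}^*}{2n^2(T-t_k^* )}$ for $k=0,\dots,K-1$ and $\gamma_K=0$. For $k=0,1,\dots,K$ in turn: 1. (Re-solve) Given the utilities $B_{t_k^*}$ accumulated so far, choose any optimal solution $\boldsymbol\xi^{\mathsf F}\in\Delta_n^L$ of $$\max\left\{\min_{i}\left(B_{t_k^*}^i+(T-t_k^* )\sum_{\ell\in[L]}p_\ell\beta_\ell^i\xi_\ell^i\right):\boldsymbol\xi\in\Delta_n^L\right\}.$$ 2. (Threshold) For each $\ell\in[L]$: pick some $j\in\arg\max_i(\xi^{\mathsf F})_\ell^i$; for $i\ne j$ set $(\xi^k)_\ell^i=(\xi^{\mathsf F})_\ell^i\,\mathbf{1}\{(\xi^{\mathsf F})_\ell^i\ge\gamma_k\}$; set $(\xi^k)_\ell^j=1-\sum_{i\ne j}(\xi^k)_\ell^i$. 3. (Act) For $t=t_k^*+1,\dots,t_{k+1}^*$: observe $b_t$, and if $b_t=\beta_\ell$ allocate $x_t=(\xi^k)_\ell$. Ties (choice of optimal solution and of $j$) are broken by an arbitrary rule depending only on the observed history. *)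

theory Defs
  imports "HOL-Probability.Probability"
begin

text \<open>
  The agents are the elements of the finite type \<open>'n\<close>, so \<open>n = CARD('n)\<close>.  The types
  \<open>1, \<dots>, L\<close> are represented by the support points \<open>\<beta>\<close> of \<open>P\<close> themselves, which are automatically
  distinct; the probability of \<open>\<beta>\<close> is \<open>pmf P \<beta>\<close>.  A realization \<open>b\<^sub>1, \<dots>, b\<^sub>T\<close> is a list \<open>bs\<close> of
  length \<open>T\<close> with \<open>b\<^sub>t = bs ! (t - 1)\<close>.
\<close>

definition alloc_simplex :: "(real ^ 'n) set" where
  "alloc_simplex = {x. (\<forall>i. 0 \<le> x $ i) \<and> (\<Sum>i\<in>UNIV. x $ i) = 1}"

definition admissible :: "(real ^ 'n) pmf \<Rightarrow> bool" where
  "admissible P \<longleftrightarrow> finite (set_pmf P) \<and> (\<forall>b\<in>set_pmf P. \<forall>i. 0 \<le> b $ i \<and> b $ i \<le> 1)"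

definition egal_welfare :: "real ^ 'n \<Rightarrow> real" where
  "egal_welfare B = (MIN i. B $ i)"

definition hindsight_opt :: "(real ^ 'n) list \<Rightarrow> real" where
  "hindsight_opt bs =
     (SUP x\<in>{x :: nat \<Rightarrow> real ^ 'n. \<forall>s<length bs. x s \<in> alloc_simplex}.
        egal_welfare (\<chi> i. \<Sum>s<length bs. bs ! s $ i * x s $ i))"

text \<open>
  A policy maps the observed utility vectors \<open>[b\<^sub>1, \<dots>, b\<^sub>t]\<close>, including the current one, to the
  allocation \<open>x\<^sub>t\<close>.
\<close>

type_synonym 'n policy = "(real ^ 'n) list \<Rightarrow> real ^ 'n"

definition cum_utility :: "'n policy \<Rightarrow> (real ^ 'n) list \<Rightarrow> real ^ 'n" where
  "cum_utility \<pi> bs = (\<chi> i. \<Sum>s<length bs. bs ! s $ i * \<pi> (take (Suc s) bs) $ i)"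

definition alg_welfare :: "'n policy \<Rightarrow> (real ^ 'n) list \<Rightarrow> real" where
  "alg_welfare \<pi> bs = egal_welfare (cum_utility \<pi> bs)"

definition regret :: "(real ^ 'n) pmf \<Rightarrow> nat \<Rightarrow> 'n policy \<Rightarrow> real" where
  "regret P T \<pi> =
     measure_pmf.expectation (replicate_pmf T P) (\<lambda>bs. hindsight_opt bs - alg_welfare \<pi> bs)"

definition birt_K :: "real \<Rightarrow> nat \<Rightarrow> nat" where
  "birt_K \<eta> T = nat \<lceil>ln (ln (real T)) / ln \<eta>\<rceil>"

text \<open>
  Neither \<open>nat\<close> nor the natural-number subtraction truncates in the intended range; see
  \<open>birt_K_no_trunc\<close> and \<open>birt_time_no_trunc\<close> below.
\<close>

definition birt_time :: "real \<Rightarrow> nat \<Rightarrow> nat \<Rightarrow> nat" where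
  "birt_time \<eta> T k =
     (if k = 0 then 0
      else if k \<le> birt_K \<eta> T then T - nat \<lfloor>exp (\<eta> ^ (birt_K \<eta> T - k))\<rfloor>
      else T)"

definition birt_threshold :: "'n::finite itself \<Rightarrow> real \<Rightarrow> nat \<Rightarrow> nat \<Rightarrow> real" where
  "birt_threshold _ \<eta> T k =
     (if k < birt_K \<eta> T
      then (real T - real (birt_time \<eta> T (Suc k)))
             / (2 * (real CARD('n))\<^sup>2 * (real T - real (birt_time \<eta> T k)))
      else 0)"

definition fluid_obj ::
  "(real ^ 'n) pmf \<Rightarrow> nat \<Rightarrow> nat \<Rightarrow> real ^ 'n \<Rightarrow> (real ^ 'n \<Rightarrow> real ^ 'n) \<Rightarrow> real" where
  "fluid_obj P T t B \<xi> =
     egal_welfare (\<chi> i. B $ i + (real T - real t) * (\<Sum>\<beta>\<in>set_pmf P. pmf P \<beta> * \<beta> $ i * \<xi> \<beta> $ i))"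

definition fluid_optimal ::
  "(real ^ 'n) pmf \<Rightarrow> nat \<Rightarrow> nat \<Rightarrow> real ^ 'n \<Rightarrow> (real ^ 'n \<Rightarrow> real ^ 'n) \<Rightarrow> bool" where
  "fluid_optimal P T t B \<xi> \<longleftrightarrow>
     is_arg_max (fluid_obj P T t B) (\<lambda>\<xi>. \<forall>\<beta>\<in>set_pmf P. \<xi> \<beta> \<in> alloc_simplex) \<xi>"

definition threshold_alloc :: "real \<Rightarrow> 'n::finite \<Rightarrow> real ^ 'n \<Rightarrow> real ^ 'n" where
  "threshold_alloc \<gamma> j x =
     (let y = (\<lambda>i. if x $ i \<ge> \<gamma> then x $ i else 0)
      in \<chi> i. if i = j then 1 - (\<Sum>i'\<in>UNIV - {j}. y i') else y i)"

text \<open>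
  In epoch \<open>k\<close>, \<open>h\<close> is the history up to \<open>t\<^sub>k\<^sup>*\<close> and \<open>h @ g\<close> the history up to and including the
  current period, whose utility vector is \<open>last g\<close>.  The fluid solution \<open>\<xi>\<close> and the indices \<open>j \<beta>\<close> are
  chosen for given \<open>k\<close> and \<open>h\<close> before \<open>g\<close> is revealed.  Ties are broken by any rule whatsoever, so
  that this is a property of policies rather than a single policy.
\<close>

definition is_BIRT :: "(real ^ 'n) pmf \<Rightarrow> real \<Rightarrow> nat \<Rightarrow> 'n policy \<Rightarrow> bool" where
  "is_BIRT P \<eta> T \<pi> \<longleftrightarrow>
     (\<forall>k\<le>birt_K \<eta> T. \<forall>h\<in>lists (set_pmf P). length h = birt_time \<eta> T k \<longrightarrow>
        (\<exists>\<xi> j.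
           fluid_optimal P T (birt_time \<eta> T k) (cum_utility \<pi> h) \<xi> \<and>
           (\<forall>\<beta>\<in>set_pmf P. is_arg_max (\<lambda>i. \<xi> \<beta> $ i) (\<lambda>_. True) (j \<beta>)) \<and>
           (\<forall>g\<in>lists (set_pmf P). g \<noteq> [] \<and> length (h @ g) \<le> birt_time \<eta> T (Suc k) \<longrightarrow>
              \<pi> (h @ g) =
                threshold_alloc (birt_threshold TYPE('n) \<eta> T k) (j (last g)) (\<xi> (last g)))))"

subsection \<open>Well-definedness\<close>

lemma ln_ln_pos:
  assumes "3 \<le> (T :: nat)"
  shows "0 < ln (ln (real T))"
proof -
  have "exp 1 < real T"
    using exp_le assms e_less_272 by linarith
  hence "ln (exp 1) < ln (real T)"
    using assms by (subst ln_less_cancel_iff) auto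
  hence "1 < ln (real T)" by simp
  thus ?thesis by simp
qed

lemma birt_K_no_trunc:
  assumes "1 < \<eta>" "3 \<le> T"
  shows "0 < \<lceil>ln (ln (real T)) / ln \<eta>\<rceil>" "0 < birt_K \<eta> T"
proof -
  have "0 < ln (ln (real T)) / ln \<eta>"
    using ln_ln_pos[OF assms(2)] assms(1) by (intro divide_pos_pos) auto
  thus "0 < \<lceil>ln (ln (real T)) / ln \<eta>\<rceil>" by simp
  thus "0 < birt_K \<eta> T" by (simp add: birt_K_def)
qed

lemma birt_time_no_trunc:
  assumes "1 < \<eta>" "3 \<le> T" "0 < k" "k \<le> birt_K \<eta> T"
  shows "real (birt_time \<eta> T k) = real T - of_int \<lfloor>exp (\<eta> ^ (birt_K \<eta> T - k))\<rfloor>"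
    and "birt_time \<eta> T k < T"
proof -
  define m where "m = birt_K \<eta> T - k"
  define z where "z = \<lfloor>exp (\<eta> ^ m)\<rfloor>"
  have lnpos: "0 < ln \<eta>" using assms(1) by simp
  have lT: "1 < ln (real T)"
    using ln_ln_pos[OF assms(2)] assms(2) by (simp add: ln_gt_zero_iff)
  have "real m \<le> real (birt_K \<eta> T) - 1" using assms(3,4) by (simp add: m_def)
  also have "\<dots> < ln (ln (real T)) / ln \<eta>"
    using birt_K_no_trunc(1)[OF assms(1,2)] unfolding birt_K_def by linarith
  finally have "real m * ln \<eta> < ln (ln (real T))" using lnpos by (simp add: field_simps)
  hence "ln (\<eta> ^ m) < ln (ln (real T))" using assms(1) by (simp add: ln_realpow)
  hence "\<eta> ^ m < ln (real T)" using assms(1) lT by (subst (asm) ln_less_cancel_iff) auto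
  hence "exp (\<eta> ^ m) < exp (ln (real T))" by simp
  hence "exp (\<eta> ^ m) < real T" using assms(2) by simp
  hence lt: "z < int T" by (simp add: z_def floor_less_iff)
  have pos: "0 < z"
    using assms(1) by (simp add: z_def)
  have eq: "birt_time \<eta> T k = T - nat z"
    using assms(3,4) by (simp add: birt_time_def z_def m_def)
  show "real (birt_time \<eta> T k) = real T - of_int \<lfloor>exp (\<eta> ^ (birt_K \<eta> T - k))\<rfloor>"
    using lt pos eq by (simp add: z_def[symmetric] m_def[symmetric] of_nat_diff)
  show "birt_time \<eta> T k < T" using lt pos eq by simp
qed

lemma alloc_simplex_nonempty: "(alloc_simplex :: (real ^ 'n) set) \<noteq> {}"
proof -
  have "(\<chi> i. 1 / real CARD('n)) \<in> (alloc_simplex :: (real ^ 'n) set)"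
    by (simp add: alloc_simplex_def)
  thus ?thesis by blast
qed

lemma compact_alloc_simplex: "compact (alloc_simplex :: (real ^ 'n) set)"
proof -
  have "alloc_simplex \<subseteq> (cbox 0 1 :: (real ^ 'n) set)"
  proof
    fix x :: "real ^ 'n" assume x: "x \<in> alloc_simplex"
    have "x $ i \<le> (\<Sum>i\<in>UNIV. x $ i)" for i
      using x by (intro member_le_sum) (auto simp: alloc_simplex_def)
    thus "x \<in> cbox 0 1"
      using x by (simp add: alloc_simplex_def mem_box_cart)
  qed
  hence bdd: "bounded (alloc_simplex :: (real ^ 'n) set)"
    using bounded_cbox bounded_subset by blast
  have "closed ((\<Inter>i. {x. 0 \<le> x $ i}) \<inter> {x :: real ^ 'n. (\<Sum>i\<in>UNIV. x $ i) = 1})"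
    by (intro closed_Int closed_INT ballI closed_Collect_le closed_Collect_eq continuous_intros)
  also have "(\<Inter>i. {x. 0 \<le> x $ i}) \<inter> {x :: real ^ 'n. (\<Sum>i\<in>UNIV. x $ i) = 1} = alloc_simplex"
    by (auto simp: alloc_simplex_def)
  finally show ?thesis using bdd by (simp add: compact_eq_bounded_closed)
qed

lemma continuous_on_MIN:
  fixes f :: "'a :: topological_space \<Rightarrow> 'b \<Rightarrow> real"
  assumes "finite I" "I \<noteq> {}" "\<And>i. i \<in> I \<Longrightarrow> continuous_on A (\<lambda>x. f x i)"
  shows "continuous_on A (\<lambda>x. MIN i\<in>I. f x i)"
  using assms
proof (induction I rule: finite_ne_induct)
  case (insert i I)
  thus ?case by (auto intro!: continuous_on_min)
qed simp

lemma egal_attained: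
  fixes c :: "real ^ 'n" and a :: "'s \<Rightarrow> real ^ 'n"
  shows "\<exists>x. is_arg_max (\<lambda>x. egal_welfare (\<chi> i. c $ i + (\<Sum>s\<in>S. a s $ i * x s $ i)))
               (\<lambda>x. \<forall>s\<in>S. x s \<in> alloc_simplex) x"
proof -
  let ?F = "\<lambda>x :: 's \<Rightarrow> real ^ 'n. egal_welfare (\<chi> i. c $ i + (\<Sum>s\<in>S. a s $ i * x s $ i))"
  let ?K = "(PiE UNIV (\<lambda>_. alloc_simplex)) :: ('s \<Rightarrow> real ^ 'n) set"
  obtain d :: "real ^ 'n" where d: "d \<in> alloc_simplex" using alloc_simplex_nonempty by blast
  have "compactin (product_topology (\<lambda>_. euclidean) UNIV) ?K"
    using compact_alloc_simplex by (subst compactin_PiE) auto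
  hence "compact ?K" by (simp add: euclidean_product_topology)
  moreover have "?K \<noteq> {}" using d by (auto simp: PiE_def Pi_def)
  moreover have "continuous_on ?K ?F"
    unfolding egal_welfare_def
    by (simp, intro continuous_on_MIN continuous_intros)
       (auto intro!: continuous_on_subset[OF continuous_on_product_coordinates])
  ultimately have "\<exists>x\<in>?K. \<forall>y\<in>?K. ?F y \<le> ?F x"
    by (rule continuous_attains_sup)
  then obtain x where xK: "x \<in> ?K" and x: "\<And>y. y \<in> ?K \<Longrightarrow> ?F y \<le> ?F x"
    by blast
  have "?F y \<le> ?F x" if y: "\<forall>s\<in>S. y s \<in> alloc_simplex" for y
  proof -
    let ?y = "\<lambda>s. if s \<in> S then y s else d"
    have "(\<Sum>s\<in>S. a s $ i * y s $ i) = (\<Sum>s\<in>S. a s $ i * ?y s $ i)" for i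
      by (rule sum.cong) simp_all
    hence "?F y = ?F ?y" by presburger
    also have "?y \<in> ?K" using y d by auto
    hence "?F ?y \<le> ?F x" by (rule x)
    finally show ?thesis .
  qed
  moreover have "\<forall>s\<in>S. x s \<in> alloc_simplex" using xK by auto
  ultimately show ?thesis unfolding is_arg_max_linorder by blast
qed

lemma hindsight_opt_attained:
  fixes bs :: "(real ^ 'n) list"
  shows "\<exists>x. is_arg_max (\<lambda>x. egal_welfare (\<chi> i. \<Sum>s<length bs. bs ! s $ i * x s $ i))
               (\<lambda>x. \<forall>s<length bs. x s \<in> alloc_simplex) x \<and>
             hindsight_opt bs = egal_welfare (\<chi> i. \<Sum>s<length bs. bs ! s $ i * x s $ i)"
proof -
  obtain x where x: "is_arg_max (\<lambda>x. egal_welfare (\<chi> i. \<Sum>s<length bs. bs ! s $ i * x s $ i))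
               (\<lambda>x. \<forall>s<length bs. x s \<in> alloc_simplex) x"
    using egal_attained[where c = 0 and S = "{..<length bs}" and a = "\<lambda>s. bs ! s"]
    by (auto simp: Ball_def)
  moreover have "hindsight_opt bs = egal_welfare (\<chi> i. \<Sum>s<length bs. bs ! s $ i * x s $ i)"
    unfolding hindsight_opt_def
    using x by (intro cSup_eq_maximum) (auto simp: is_arg_max_linorder)
  ultimately show ?thesis by blast
qed

lemma fluid_optimal_exists:
  fixes P :: "(real ^ 'n) pmf"
  shows "\<exists>\<xi>. fluid_optimal P T t B \<xi>"
proof -
  let ?a = "\<lambda>\<beta>. ((real T - real t) * pmf P \<beta>) *\<^sub>R \<beta>"
  have "fluid_obj P T t B =
      (\<lambda>\<xi>. egal_welfare (\<chi> i. B $ i + (\<Sum>\<beta>\<in>set_pmf P. ?a \<beta> $ i * \<xi> \<beta> $ i)))"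
    unfolding fluid_obj_def by (simp add: sum_distrib_left mult.assoc)
  thus ?thesis
    using egal_attained[where c = B and S = "set_pmf P" and a = ?a]
    unfolding fluid_optimal_def by simp
qed

end

theory Submission
  imports Defs
begin

text \<open>
  The target \<open>w = OPT\<close> is attained by a plan for the realized counts, and we follow it from epoch to
  epoch.  Suppose \<open>w\<close> is still attainable at \<open>t\<^sub>k\<^sup>*\<close>, and the counts of the remaining periods after
  \<open>t\<^sub>k\<^sup>*\<close> and after \<open>t\<^sub>k\<^sub>+\<^sub>1\<^sup>*\<close> deviate from their means by at most
  \<open>c (T - t\<^sub>k\<^sub>+\<^sub>1\<^sup>*)\<^sup>2 / (T - t\<^sub>k\<^sup>*)\<close>.  By a Hoffman error bound, whose constant depends on the support of
  \<open>P\<close> only, some plan attaining \<open>w\<close> lies close to the fluid solution; the threshold guarantees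
  that this plan dominates everything handed out in the epoch, so \<open>w\<close> is still attainable at
  \<open>t\<^sub>k\<^sub>+\<^sub>1\<^sup>*\<close>.  Otherwise lowering \<open>w\<close> by \<open>T - t\<^sub>k\<^sup>*\<close> suffices.  Since \<open>\<eta> < 4/3\<close>, the tolerance exceeds
  the standard deviation \<open>(T - t\<^sub>k\<^sup>*)\<^sup>1\<^sup>/\<^sup>2\<close> by a power of \<open>T - t\<^sub>k\<^sup>*\<close>, and Hoeffding's inequality makes the
  expected losses summable, uniformly in \<open>T\<close>.  The last epoch has at most two periods.
\<close>

subsection \<open>A Hoffman error bound by Fourier--Motzkin elimination\<close>

text \<open>Clipping \<open>x\<close> to the interval between the largest \<open>lo\<close> and the
  smallest \<open>hi\<close> moves it by at most \<open>D\<close>, since no limit is violated by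
  more. The eliminated variable of the Hoffman bound is chosen in this way.\<close>

lemma clip_between:
  fixes lo hi :: "'r \<Rightarrow> real"
  assumes "finite L" "finite H"
    and sep: "\<And>l h. l \<in> L \<Longrightarrow> h \<in> H \<Longrightarrow> lo l \<le> hi h"
    and L: "\<And>l. l \<in> L \<Longrightarrow> lo l \<le> x + D" and H: "\<And>h. h \<in> H \<Longrightarrow> x - D \<le> hi h"
    and "0 \<le> D"
  shows "\<exists>t. (\<forall>l\<in>L. lo l \<le> t) \<and> (\<forall>h\<in>H. t \<le> hi h) \<and> \<bar>t - x\<bar> \<le> D"
proof -
  \<comment> \<open>\<open>x\<close> is first cut down to the upper limits, then raised to the lower
    ones; the insertions also cover empty \<open>H\<close> or \<open>L\<close>.\<close>
  define t where "t = Max (insert (Min (insert x (hi ` H))) (lo ` L))"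
  have "lo l \<le> t" if "l \<in> L" for l
    unfolding t_def using that assms(1) by (intro Max_ge) auto
  moreover have "t \<le> hi h" if "h \<in> H" for h
    unfolding t_def using that assms(1,2) sep by (auto intro!: Min_le)
  moreover have "t \<le> x + D"
  proof -
    have "Min (insert x (hi ` H)) \<le> x" using assms(2) by (intro Min_le) auto
    hence "Min (insert x (hi ` H)) \<le> x + D" using assms(6) by linarith
    thus ?thesis unfolding t_def using assms(1) L by (subst Max_le_iff) auto
  qed
  moreover have "x - D \<le> t"
  proof -
    have "x - D \<le> Min (insert x (hi ` H))" using assms(2,6) H by (subst Min_ge_iff) auto
    also have "\<dots> \<le> t" unfolding t_def using assms(1) by (intro Max_ge) auto
    finally show ?thesis .
  qed
  ultimately show ?thesis by (intro exI[of _ t]) auto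
qed

text \<open>Induction on the variables: the system with \<open>u\<close> eliminated has a solution
  near \<open>x\<close>, and a value for \<open>u\<close> is then found near \<open>x u\<close>.
  \<open>\<kappa>\<close> is chosen before \<open>b\<close>, so it depends on the coefficients
  alone. Rows are numbered by \<open>nat\<close> because elimination pairs them and the induction
  needs labels of the same type again.\<close>

lemma hoffman_bound_nat:
  fixes A :: "nat \<Rightarrow> 'v \<Rightarrow> real"
  assumes "finite I" "finite R"
  shows "\<exists>\<kappa>\<ge>0. \<forall>b x y \<epsilon>. 0 \<le> \<epsilon> \<longrightarrow>
           (\<forall>r\<in>R. (\<Sum>v\<in>I. A r v * x v) \<le> b r + \<epsilon>) \<longrightarrow>
           (\<forall>r\<in>R. (\<Sum>v\<in>I. A r v * y v) \<le> b r) \<longrightarrow>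
           (\<exists>z. (\<forall>r\<in>R. (\<Sum>v\<in>I. A r v * z v) \<le> b r) \<and> (\<forall>v\<in>I. \<bar>z v - x v\<bar> \<le> \<kappa> * \<epsilon>))"
  using assms
proof (induction I arbitrary: R A rule: finite_induct)
  case empty
  show ?case by (rule exI[of _ 0]) auto
next
  case (insert u I)
  define P where "P = {r\<in>R. A r u > 0}"
  define N where "N = {r\<in>R. A r u < 0}"
  define Z where "Z = {r\<in>R. A r u = 0}"
  have fin: "finite P" "finite N" "finite Z" using insert.prems by (auto simp: P_def N_def Z_def)
  \<comment> \<open>\<open>prod_encode (r, s)\<close> labels the combination of \<open>r\<close> and \<open>s\<close> that eliminates \<open>u\<close>; \<open>(r, r)\<close> keeps a row free of \<open>u\<close>.\<close>
  define R' where "R' = prod_encode ` (P \<times> N \<union> (\<lambda>r. (r, r)) ` Z)"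
  have finR': "finite R'" using fin by (auto simp: R'_def)
  define comb where "comb f p = (case prod_decode p of (r, s) \<Rightarrow>
      if r = s then f r else f r / A r u - f s / A s u)" for f :: "nat \<Rightarrow> real" and p
  define A' where "A' p v = comb (\<lambda>r. A r v) p" for p v
  have comb_sum: "(\<Sum>v\<in>I. A' p v * x v) = comb (\<lambda>r. \<Sum>v\<in>I. A r v * x v) p" for p x
    by (cases "prod_decode p")
       (auto simp: A'_def comb_def sum_subtractf left_diff_distrib sum_divide_distrib)
  obtain \<kappa>' where \<kappa>': "0 \<le> \<kappa>'"
    and IH: "\<And>b x y \<epsilon>. 0 \<le> \<epsilon> \<Longrightarrow>
           \<forall>r\<in>R'. (\<Sum>v\<in>I. A' r v * x v) \<le> b r + \<epsilon> \<Longrightarrow>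
           \<forall>r\<in>R'. (\<Sum>v\<in>I. A' r v * y v) \<le> b r \<Longrightarrow>
           (\<exists>z. (\<forall>r\<in>R'. (\<Sum>v\<in>I. A' r v * z v) \<le> b r) \<and> (\<forall>v\<in>I. \<bar>z v - x v\<bar> \<le> \<kappa>' * \<epsilon>))"
    using insert.IH[OF finR', of A'] by blast
  \<comment> \<open>\<open>c\<close> bounds the factor by which combining two rows enlarges a
    violation; the summand 1 covers the rows kept from \<open>Z\<close>. \<open>d\<close> bounds how
    far \<open>u\<close> must move: a row's own violation plus the effect of moving the other
    variables, divided by the coefficient of \<open>u\<close>.\<close>
  define c where "c = 1 + 2 * (\<Sum>r\<in>R. 1 / \<bar>A r u\<bar>)"
  define d where "d = (\<Sum>r\<in>R. (1 + (\<Sum>v\<in>I. \<bar>A r v\<bar>) * \<kappa>' * c) / \<bar>A r u\<bar>)"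
  have c0: "1 \<le> c" unfolding c_def by (simp add: sum_nonneg)
  have cle: "1 / \<bar>A r u\<bar> + 1 / \<bar>A s u\<bar> \<le> c" if "r \<in> R" "s \<in> R" for r s
  proof -
    have *: "1 / \<bar>A r u\<bar> \<le> (\<Sum>r\<in>R. 1 / \<bar>A r u\<bar>)" if "r \<in> R" for r
      using that insert.prems by (intro member_le_sum) auto
    show ?thesis unfolding c_def using *[OF that(1)] *[OF that(2)] by linarith
  qed
  have dterm: "0 \<le> (1 + (\<Sum>v\<in>I. \<bar>A r v\<bar>) * \<kappa>' * c) / \<bar>A r u\<bar>" for r
    using \<kappa>' c0 by (intro divide_nonneg_nonneg add_nonneg_nonneg mult_nonneg_nonneg sum_nonneg) auto
  have d0: "0 \<le> d" unfolding d_def by (intro sum_nonneg dterm)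
  have dle: "(1 + (\<Sum>v\<in>I. \<bar>A r v\<bar>) * \<kappa>' * c) / \<bar>A r u\<bar> \<le> d" if "r \<in> R" for r
    unfolding d_def using that insert.prems dterm by (intro member_le_sum) auto
  show ?case
  proof (intro exI[of _ "d + \<kappa>' * c"] conjI allI impI)
    show "0 \<le> d + \<kappa>' * c" using d0 \<kappa>' c0 by simp
    fix b x y and \<epsilon> :: real
    assume \<epsilon>: "0 \<le> \<epsilon>"
      and x: "\<forall>r\<in>R. (\<Sum>v\<in>insert u I. A r v * x v) \<le> b r + \<epsilon>"
      and y: "\<forall>r\<in>R. (\<Sum>v\<in>insert u I. A r v * y v) \<le> b r"
    define S where "S f r = (\<Sum>v\<in>I. A r v * f v)" for f r
    have full: "(\<Sum>v\<in>insert u I. A r v * f v) = A r u * f u + S f r" for f r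
      using insert.hyps by (simp add: S_def)
    \<comment> \<open>Dividing by the coefficients of \<open>u\<close> makes \<open>f u\<close>
      cancel. This serves twice: for \<open>x\<close> with violation \<open>\<epsilon>\<close> and
      for the feasible \<open>y\<close> with violation 0.\<close>
    have comb_le: "comb (S f) p \<le> comb b p + c * e"
      if f: "\<forall>r\<in>R. A r u * f u + S f r \<le> b r + e" and e: "0 \<le> e" and p: "p \<in> R'" for f p e
    proof -
      consider (1) r s where "r \<in> P" "s \<in> N" "p = prod_encode (r, s)"
        | (2) r where "r \<in> Z" "p = prod_encode (r, r)"
        using p by (auto simp: R'_def)
      thus ?thesis
      proof cases
        case 1
        have rs: "r \<in> R" "s \<in> R" "A r u > 0" "A s u < 0" "r \<noteq> s"
          using 1 by (auto simp: P_def N_def)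
        have "S f r / A r u \<le> (b r + e - A r u * f u) / A r u"
          using f rs by (intro divide_right_mono) force+
        hence 1: "S f r / A r u \<le> b r / A r u + e / A r u - f u"
          using rs by (simp add: field_simps)
        have "(b s + e - A s u * f u) / A s u \<le> S f s / A s u"
          using f rs by (intro divide_right_mono_neg) force+
        hence 2: "b s / A s u + e / A s u - f u \<le> S f s / A s u"
          using rs by (simp add: field_simps)
        have "e / A r u - e / A s u = e * (1 / \<bar>A r u\<bar> + 1 / \<bar>A s u\<bar>)"
          using rs by (simp add: field_simps)
        also have "\<dots> \<le> e * c" using cle[OF rs(1,2)] e by (intro mult_left_mono)
        finally show ?thesis using 1 2 rs \<open>p = _\<close> by (simp add: comb_def mult.commute)
      next
        case 2
        have "1 * e \<le> c * e" using c0 e by (intro mult_right_mono) auto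
        moreover have "r \<in> R" "A r u = 0" using 2 by (auto simp: Z_def)
        ultimately show ?thesis using f 2 by (fastforce simp: comb_def)
      qed
    qed
    have "0 \<le> c * \<epsilon>" using c0 \<epsilon> by simp
    from IH[OF this, of x "comb b" y] obtain z where
      "\<forall>p\<in>R'. comb (S z) p \<le> comb b p" "\<forall>v\<in>I. \<bar>z v - x v\<bar> \<le> \<kappa>' * (c * \<epsilon>)"
      using comb_le[of x \<epsilon>] comb_le[of y 0] x y \<epsilon>
      unfolding comb_sum S_def[symmetric] full by auto
    hence z: "\<And>p. p \<in> R' \<Longrightarrow> comb (S z) p \<le> comb b p"
      "\<And>v. v \<in> I \<Longrightarrow> \<bar>z v - x v\<bar> \<le> \<kappa>' * (c * \<epsilon>)" by auto
    \<comment> \<open>With the other variables fixed at \<open>z\<close>, row \<open>r\<close>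
      bounds \<open>u\<close> by \<open>lim r\<close>, from above on \<open>P\<close> and from below
      on \<open>N\<close>.\<close>
    define lim where "lim r = (b r - S z r) / A r u" for r
    have Sdiff: "\<bar>S z r - S x r\<bar> \<le> (\<Sum>v\<in>I. \<bar>A r v\<bar>) * \<kappa>' * c * \<epsilon>" for r
    proof -
      have "\<bar>S z r - S x r\<bar> = \<bar>\<Sum>v\<in>I. A r v * (z v - x v)\<bar>"
        by (simp add: S_def sum_subtractf right_diff_distrib)
      also have "\<dots> \<le> (\<Sum>v\<in>I. \<bar>A r v\<bar> * \<bar>z v - x v\<bar>)"
        by (rule order_trans[OF sum_abs]) (simp add: abs_mult)
      also have "\<dots> \<le> (\<Sum>v\<in>I. \<bar>A r v\<bar> * (\<kappa>' * (c * \<epsilon>)))"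
        using z(2) by (intro sum_mono mult_left_mono) auto
      finally show ?thesis by (simp add: sum_distrib_right mult.assoc)
    qed
    have rbound: "A r u * x u \<le> b r - S z r + (\<bar>A r u\<bar> * (d * \<epsilon>))" if "r \<in> R" "A r u \<noteq> 0" for r
    proof -
      have "A r u * x u \<le> b r - S z r + (1 + (\<Sum>v\<in>I. \<bar>A r v\<bar>) * \<kappa>' * c) * \<epsilon>"
        using x[rule_format, OF that(1)] Sdiff[of r] unfolding full by (simp add: algebra_simps)
      also have "(1 + (\<Sum>v\<in>I. \<bar>A r v\<bar>) * \<kappa>' * c) * \<epsilon> \<le> (\<bar>A r u\<bar> * d) * \<epsilon>"
        using dle[OF that(1)] that(2) \<epsilon> by (intro mult_right_mono) (auto simp: field_simps)
      finally show ?thesis by (simp add: mult.assoc)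
    qed
    \<comment> \<open>Lower limits lie below upper ones because \<open>z\<close> satisfies the
      combined rows; by \<open>rbound\<close>, \<open>x u\<close> violates no limit by more than
      \<open>d * \<epsilon>\<close>.\<close>
    have "\<exists>t. (\<forall>s\<in>N. lim s \<le> t) \<and> (\<forall>r\<in>P. t \<le> lim r) \<and> \<bar>t - x u\<bar> \<le> d * \<epsilon>"
    proof (rule clip_between)
      fix s r assume sr: "s \<in> N" "r \<in> P"
      hence "comb (S z) (prod_encode (r, s)) \<le> comb b (prod_encode (r, s))"
        by (intro z) (auto simp: R'_def)
      moreover have "r \<noteq> s" using sr by (auto simp: P_def N_def)
      ultimately show "lim s \<le> lim r" by (simp add: comb_def lim_def diff_divide_distrib)
    next
      fix s assume "s \<in> N"
      hence s: "s \<in> R" "A s u < 0" by (auto simp: N_def)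
      hence "A s u * (x u + d * \<epsilon>) \<le> b s - S z s" using rbound[of s] by (simp add: algebra_simps)
      thus "lim s \<le> x u + d * \<epsilon>" using s by (simp add: lim_def field_simps)
    next
      fix s assume "s \<in> P"
      hence s: "s \<in> R" "A s u > 0" by (auto simp: P_def)
      hence "A s u * (x u - d * \<epsilon>) \<le> b s - S z s" using rbound[of s] by (simp add: algebra_simps)
      thus "x u - d * \<epsilon> \<le> lim s" using s by (simp add: lim_def field_simps)
    qed (use fin d0 \<epsilon> in auto)
    then obtain t where t: "\<And>s. s \<in> N \<Longrightarrow> lim s \<le> t" "\<And>r. r \<in> P \<Longrightarrow> t \<le> lim r" "\<bar>t - x u\<bar> \<le> d * \<epsilon>"
      by blast
    define z' where "z' = z(u := t)"
    have Sz': "S z' r = S z r" for r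
      unfolding S_def z'_def using insert.hyps by (intro sum.cong) auto
    have "A r u * t + S z r \<le> b r" if r: "r \<in> R" for r
    proof -
      consider "r \<in> P" | "r \<in> N" | "r \<in> Z" using r by (force simp: P_def N_def Z_def)
      thus ?thesis
      proof cases
        case 1
        thus ?thesis using t(2)[of r] by (simp add: lim_def P_def field_simps)
      next
        case 2
        thus ?thesis using t(1)[of r] by (simp add: lim_def N_def field_simps)
      next
        case 3
        hence "comb (S z) (prod_encode (r, r)) \<le> comb b (prod_encode (r, r))"
          by (intro z) (auto simp: R'_def)
        thus ?thesis using 3 by (simp add: comb_def Z_def)
      qed
    qed
    hence "\<forall>r\<in>R. (\<Sum>v\<in>insert u I. A r v * z' v) \<le> b r"
      unfolding full Sz' by (simp add: z'_def)
    moreover have "\<forall>v\<in>insert u I. \<bar>z' v - x v\<bar> \<le> (d + \<kappa>' * c) * \<epsilon>"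
    proof
      fix v assume "v \<in> insert u I"
      moreover have "0 \<le> d * \<epsilon>" "0 \<le> \<kappa>' * (c * \<epsilon>)" using d0 \<kappa>' c0 \<epsilon> by auto
      ultimately show "\<bar>z' v - x v\<bar> \<le> (d + \<kappa>' * c) * \<epsilon>"
        using t(3) z(2)[of v] by (fastforce simp: z'_def algebra_simps)
    qed
    ultimately show "\<exists>z. (\<forall>r\<in>R. (\<Sum>v\<in>insert u I. A r v * z v) \<le> b r) \<and>
        (\<forall>v\<in>insert u I. \<bar>z v - x v\<bar> \<le> (d + \<kappa>' * c) * \<epsilon>)" by blast
  qed
qed

text \<open>An injection \<open>e\<close> of \<open>R\<close> into \<open>nat\<close> with inverse
  \<open>g\<close> reduces arbitrary row labels to numbered rows.\<close>

lemma hoffman_bound: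
  fixes A :: "'r \<Rightarrow> 'v \<Rightarrow> real"
  assumes "finite I" "finite R"
  shows "\<exists>\<kappa>\<ge>0. \<forall>b x y \<epsilon>. 0 \<le> \<epsilon> \<longrightarrow>
           (\<forall>r\<in>R. (\<Sum>v\<in>I. A r v * x v) \<le> b r + \<epsilon>) \<longrightarrow>
           (\<forall>r\<in>R. (\<Sum>v\<in>I. A r v * y v) \<le> b r) \<longrightarrow>
           (\<exists>z. (\<forall>r\<in>R. (\<Sum>v\<in>I. A r v * z v) \<le> b r) \<and> (\<forall>v\<in>I. \<bar>z v - x v\<bar> \<le> \<kappa> * \<epsilon>))"
proof -
  obtain e :: "'r \<Rightarrow> nat" where e: "inj_on e R"
    using finite_imp_inj_to_nat_seg[OF assms(2)] by blast
  define g where "g = the_inv_into R e"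
  have g: "g (e r) = r" if "r \<in> R" for r
    using that e by (simp add: g_def the_inv_into_f_f)
  obtain \<kappa> where \<kappa>: "0 \<le> \<kappa>" and H: "\<And>b x y \<epsilon>. 0 \<le> \<epsilon> \<Longrightarrow>
           \<forall>r\<in>e ` R. (\<Sum>v\<in>I. A (g r) v * x v) \<le> b r + \<epsilon> \<Longrightarrow>
           \<forall>r\<in>e ` R. (\<Sum>v\<in>I. A (g r) v * y v) \<le> b r \<Longrightarrow>
           (\<exists>z. (\<forall>r\<in>e ` R. (\<Sum>v\<in>I. A (g r) v * z v) \<le> b r) \<and> (\<forall>v\<in>I. \<bar>z v - x v\<bar> \<le> \<kappa> * \<epsilon>))"
    using hoffman_bound_nat[of I "e ` R" "\<lambda>r. A (g r)"] assms by blast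
  show ?thesis
  proof (intro exI[of _ \<kappa>] conjI allI impI)
    fix b x y and \<epsilon> :: real
    assume "0 \<le> \<epsilon>" "\<forall>r\<in>R. (\<Sum>v\<in>I. A r v * x v) \<le> b r + \<epsilon>" "\<forall>r\<in>R. (\<Sum>v\<in>I. A r v * y v) \<le> b r"
    with H[of \<epsilon> x "\<lambda>r. b (g r)" y] g
    show "\<exists>z. (\<forall>r\<in>R. (\<Sum>v\<in>I. A r v * z v) \<le> b r) \<and> (\<forall>v\<in>I. \<bar>z v - x v\<bar> \<le> \<kappa> * \<epsilon>)"
      by simp
  qed (rule \<kappa>)
qed

subsection \<open>Plans for given counts\<close>

text \<open>\<open>z \<beta> i\<close> is the number of arrivals of type \<open>\<beta>\<close> that agent \<open>i\<close> receives.  Since utilities are nonnegative,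
  not handing out all arrivals is allowed.\<close>

definition is_plan ::
  "(real ^ 'n) set \<Rightarrow> (real ^ 'n) \<Rightarrow> (real ^ 'n \<Rightarrow> real) \<Rightarrow> real \<Rightarrow> (real ^ 'n \<Rightarrow> 'n \<Rightarrow> real) \<Rightarrow> bool"
  where "is_plan S B N w z \<longleftrightarrow>
    (\<forall>\<beta>\<in>S. (\<forall>i. 0 \<le> z \<beta> i) \<and> (\<Sum>i\<in>UNIV. z \<beta> i) \<le> N \<beta>) \<and>
    (\<forall>i. w \<le> B $ i + (\<Sum>\<beta>\<in>S. \<beta> $ i * z \<beta> i))"

lemma is_planI:
  assumes "\<And>\<beta> i. \<beta> \<in> S \<Longrightarrow> 0 \<le> z \<beta> i" "\<And>\<beta>. \<beta> \<in> S \<Longrightarrow> (\<Sum>i\<in>UNIV. z \<beta> i) \<le> N \<beta>"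
    "\<And>i. w \<le> B $ i + (\<Sum>\<beta>\<in>S. \<beta> $ i * z \<beta> i)"
  shows "is_plan S B N w z"
  using assms by (simp add: is_plan_def)

lemma is_planD:
  assumes "is_plan S B N w z"
  shows "\<beta> \<in> S \<Longrightarrow> 0 \<le> z \<beta> i" "\<beta> \<in> S \<Longrightarrow> (\<Sum>i\<in>UNIV. z \<beta> i) \<le> N \<beta>"
    "w \<le> B $ i + (\<Sum>\<beta>\<in>S. \<beta> $ i * z \<beta> i)"
  using assms by (auto simp: is_plan_def)

text \<open>Labels for the inequalities of \<open>is_plan\<close>, read as rows of a linear system
  with upper bounds; hence the negative signs for nonnegativity and targets.\<close>

datatype 'n plan_row = Nonneg "real ^ 'n" 'n | Supply "real ^ 'n" | Target 'n

fun plan_coeff :: "'n plan_row \<Rightarrow> (real ^ 'n) \<times> 'n \<Rightarrow> real" where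
  "plan_coeff (Nonneg \<beta> i) v = (if v = (\<beta>, i) then - 1 else 0)"
| "plan_coeff (Supply \<beta>) v = (if fst v = \<beta> then 1 else 0)"
| "plan_coeff (Target i) v = (if snd v = i then - (fst v $ i) else 0)"

fun plan_rhs :: "(real ^ 'n) \<Rightarrow> (real ^ 'n \<Rightarrow> real) \<Rightarrow> real \<Rightarrow> 'n plan_row \<Rightarrow> real" where
  "plan_rhs B N w (Nonneg \<beta> i) = 0"
| "plan_rhs B N w (Supply \<beta>) = N \<beta>"
| "plan_rhs B N w (Target i) = B $ i - w"

lemma plan_coeff_sum:
  fixes S :: "(real ^ 'n::finite) set"
  assumes "finite S"
  shows "\<beta> \<in> S \<Longrightarrow> (\<Sum>v\<in>S \<times> UNIV. plan_coeff (Nonneg \<beta> i) v * z v) = - z (\<beta>, i)"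
    and "\<beta> \<in> S \<Longrightarrow> (\<Sum>v\<in>S \<times> UNIV. plan_coeff (Supply \<beta>) v * z v) = (\<Sum>i\<in>UNIV. z (\<beta>, i))"
    and "(\<Sum>v\<in>S \<times> UNIV. plan_coeff (Target i) v * z v) = - (\<Sum>\<beta>\<in>S. \<beta> $ i * z (\<beta>, i))"
proof -
  assume "\<beta> \<in> S"
  have "(\<Sum>v\<in>S \<times> UNIV. plan_coeff (Nonneg \<beta> i) v * z v) =
      (\<Sum>v\<in>S \<times> UNIV. if v = (\<beta>, i) then - z v else 0)"
    by (intro sum.cong) auto
  also have "\<dots> = - z (\<beta>, i)" using assms \<open>\<beta> \<in> S\<close> by (subst sum.delta) auto
  finally show "(\<Sum>v\<in>S \<times> UNIV. plan_coeff (Nonneg \<beta> i) v * z v) = - z (\<beta>, i)" .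
next
  assume "\<beta> \<in> S"
  have "(\<Sum>v\<in>S \<times> UNIV. plan_coeff (Supply \<beta>) v * z v) =
      (\<Sum>\<beta>'\<in>S. \<Sum>i\<in>UNIV. if \<beta>' = \<beta> then z (\<beta>, i) else 0)"
    by (subst sum.cartesian_product) (auto intro!: sum.cong)
  also have "\<dots> = (\<Sum>i\<in>UNIV. z (\<beta>, i))"
    using assms \<open>\<beta> \<in> S\<close> by (subst sum.swap) (simp add: sum.delta)
  finally show "(\<Sum>v\<in>S \<times> UNIV. plan_coeff (Supply \<beta>) v * z v) = (\<Sum>i\<in>UNIV. z (\<beta>, i))" .
next
  have "(\<Sum>v\<in>S \<times> UNIV. plan_coeff (Target i) v * z v) =
      (\<Sum>\<beta>\<in>S. \<Sum>i'\<in>UNIV. if i' = i then - (\<beta> $ i * z (\<beta>, i)) else 0)"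
    by (subst sum.cartesian_product) (auto intro!: sum.cong)
  also have "\<dots> = - (\<Sum>\<beta>\<in>S. \<beta> $ i * z (\<beta>, i))"
    by (simp add: sum.delta sum_negf)
  finally show "(\<Sum>v\<in>S \<times> UNIV. plan_coeff (Target i) v * z v) = - (\<Sum>\<beta>\<in>S. \<beta> $ i * z (\<beta>, i))" .
qed

text \<open>The coefficients of the rows depend on \<open>S\<close> only, while \<open>B\<close>,
  \<open>N\<close> and \<open>w\<close> enter the right-hand sides. So one Hoffman constant serves
  every history, count vector and target.\<close>

lemma plan_stability:
  fixes S :: "(real ^ 'n::finite) set"
  assumes "finite S"
  shows "\<exists>\<kappa>\<ge>0. \<forall>B N w \<epsilon> x y. 0 \<le> \<epsilon> \<longrightarrow> is_plan S B N w y \<longrightarrow>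
           is_plan S B (\<lambda>\<beta>. N \<beta> + \<epsilon>) (w - \<epsilon>) x \<longrightarrow>
           (\<exists>z. is_plan S B N w z \<and> (\<forall>\<beta>\<in>S. \<forall>i. \<bar>z \<beta> i - x \<beta> i\<bar> \<le> \<kappa> * \<epsilon>))"
proof -
  define R where "R = (\<lambda>(\<beta>, i). Nonneg \<beta> i) ` (S \<times> UNIV) \<union> Supply ` S \<union> range Target"
  let ?I = "S \<times> (UNIV :: 'n set)"
  have "finite R" "finite ?I" using assms by (auto simp: R_def)
  then obtain \<kappa> where \<kappa>: "0 \<le> \<kappa>" and H: "\<And>b x y \<epsilon>. 0 \<le> \<epsilon> \<Longrightarrow>
           (\<forall>r\<in>R. (\<Sum>v\<in>?I. plan_coeff r v * x v) \<le> b r + \<epsilon>) \<Longrightarrow>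
           (\<forall>r\<in>R. (\<Sum>v\<in>?I. plan_coeff r v * y v) \<le> b r) \<Longrightarrow>
           (\<exists>z. (\<forall>r\<in>R. (\<Sum>v\<in>?I. plan_coeff r v * z v) \<le> b r) \<and> (\<forall>v\<in>?I. \<bar>z v - x v\<bar> \<le> \<kappa> * \<epsilon>))"
    using hoffman_bound[of ?I R plan_coeff] by blast
  have split_rows: "(\<forall>r\<in>R. Q r) \<longleftrightarrow>
      (\<forall>\<beta>\<in>S. (\<forall>i. Q (Nonneg \<beta> i)) \<and> Q (Supply \<beta>)) \<and> (\<forall>i. Q (Target i))" for Q
    by (auto simp: R_def)
  \<comment> \<open>The slack allows two readings: the relaxed system for \<open>x\<close>, and with
    slack 0 the exact one for \<open>y\<close> and \<open>z\<close>.\<close>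
  have row: "(\<forall>r\<in>R. (\<Sum>v\<in>?I. plan_coeff r v * x v) \<le> plan_rhs B N w r + \<epsilon>) \<longleftrightarrow>
      (\<forall>\<beta>\<in>S. (\<forall>i. - x (\<beta>, i) \<le> \<epsilon>) \<and> (\<Sum>i\<in>UNIV. x (\<beta>, i)) \<le> N \<beta> + \<epsilon>) \<and>
      (\<forall>i. - (\<Sum>\<beta>\<in>S. \<beta> $ i * x (\<beta>, i)) \<le> B $ i - w + \<epsilon>)" for x B N w and \<epsilon> :: real
    unfolding split_rows by (simp add: plan_coeff_sum[OF assms] del: plan_coeff.simps)
  show ?thesis
  proof (intro exI[of _ \<kappa>] conjI allI impI)
    fix B N w x y and \<epsilon> :: real
    assume \<epsilon>: "0 \<le> \<epsilon>" and y: "is_plan S B N w y" and x: "is_plan S B (\<lambda>\<beta>. N \<beta> + \<epsilon>) (w - \<epsilon>) x"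
    have "\<forall>r\<in>R. (\<Sum>v\<in>?I. plan_coeff r v * case_prod x v) \<le> plan_rhs B N w r + \<epsilon>"
    proof -
      have "- x \<beta> i \<le> \<epsilon>" if "\<beta> \<in> S" for \<beta> i
        using is_planD(1)[OF x that, of i] \<epsilon> by linarith
      moreover have "- (\<Sum>\<beta>\<in>S. \<beta> $ i * x \<beta> i) \<le> B $ i - w + \<epsilon>" for i
        using is_planD(3)[OF x, of i] by linarith
      ultimately show ?thesis unfolding row using is_planD(2)[OF x] by simp
    qed
    moreover have "\<forall>r\<in>R. (\<Sum>v\<in>?I. plan_coeff r v * case_prod y v) \<le> plan_rhs B N w r"
    proof -
      have "- (\<Sum>\<beta>\<in>S. \<beta> $ i * y \<beta> i) \<le> B $ i - w" for i
        using is_planD(3)[OF y, of i] by linarith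
      thus ?thesis using row[of "case_prod y" B N w 0] is_planD(1,2)[OF y] by simp
    qed
    ultimately obtain z where z: "\<forall>r\<in>R. (\<Sum>v\<in>?I. plan_coeff r v * z v) \<le> plan_rhs B N w r"
        "\<forall>v\<in>?I. \<bar>z v - case_prod x v\<bar> \<le> \<kappa> * \<epsilon>"
      using H[OF \<epsilon>] by blast
    have rows: "(\<forall>\<beta>\<in>S. (\<forall>i. 0 \<le> z (\<beta>, i)) \<and> (\<Sum>i\<in>UNIV. z (\<beta>, i)) \<le> N \<beta>)"
        "\<And>i. - (\<Sum>\<beta>\<in>S. \<beta> $ i * z (\<beta>, i)) \<le> B $ i - w"
      using z(1) row[of z B N w 0] by auto
    have "is_plan S B N w (curry z)"
    proof (rule is_planI)
      fix i
      show "w \<le> B $ i + (\<Sum>\<beta>\<in>S. \<beta> $ i * curry z \<beta> i)" using rows(2)[of i] by simp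
    qed (use rows(1) in auto)
    thus "\<exists>z. is_plan S B N w z \<and> (\<forall>\<beta>\<in>S. \<forall>i. \<bar>z \<beta> i - x \<beta> i\<bar> \<le> \<kappa> * \<epsilon>)"
      using z(2) by (intro exI[of _ "curry z"]) auto
  qed (rule \<kappa>)
qed

text \<open>The plan \<open>z\<close> for the counts \<open>N\<close> becomes an allocation
  \<open>y\<close> of the mean counts that loses at most \<open>\<delta>\<close> per type, as
  utilities are at most 1. The optimal \<open>\<xi>\<close> is worth at least as much as
  \<open>y\<close>.\<close>

lemma fluid_near_optimal:
  fixes P :: "(real ^ 'n::finite) pmf"
  defines "S \<equiv> set_pmf P"
  assumes "admissible P" "fluid_optimal P T t B \<xi>" "t < T" "is_plan S B N w z"
    and dev: "\<And>\<beta>. \<beta> \<in> S \<Longrightarrow> \<bar>N \<beta> - (real T - real t) * pmf P \<beta>\<bar> \<le> \<delta>"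
  shows "is_plan S B (\<lambda>\<beta>. (real T - real t) * pmf P \<beta>) (w - real (card S) * \<delta>)
           (\<lambda>\<beta> i. (real T - real t) * pmf P \<beta> * \<xi> \<beta> $ i)"
proof -
  define q where "q \<beta> = (real T - real t) * pmf P \<beta>" for \<beta>
  have q: "0 < q \<beta>" if "\<beta> \<in> S" for \<beta>
    using that \<open>t < T\<close> by (simp add: q_def S_def pmf_positive)
  have \<beta>01: "0 \<le> \<beta> $ i" "\<beta> $ i \<le> 1" if "\<beta> \<in> S" for \<beta> i
    using that assms by (auto simp: admissible_def S_def)
  have \<xi>: "\<beta> \<in> S \<Longrightarrow> \<xi> \<beta> \<in> alloc_simplex" for \<beta>
    using assms(3) by (auto simp: fluid_optimal_def is_arg_max_def S_def)
  have obj: "fluid_obj P T t B x = (MIN i. B $ i + (\<Sum>\<beta>\<in>S. \<beta> $ i * (q \<beta> * x \<beta> $ i)))" for x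
    by (simp add: fluid_obj_def egal_welfare_def q_def S_def sum_distrib_left mult_ac)
  note z = is_planD[OF assms(5)]
  \<comment> \<open>Dividing by the larger of realized and mean count gives shares of total at most
    1 with a positive denominator. The rest goes to \<open>undefined\<close>, one arbitrary
    agent.\<close>
  define m where "m \<beta> = max (N \<beta>) (q \<beta>)" for \<beta>
  define y :: "real ^ 'n \<Rightarrow> real ^ 'n" where
    "y \<beta> = (\<chi> i. z \<beta> i / m \<beta> + (if i = undefined then 1 - (\<Sum>i\<in>UNIV. z \<beta> i) / m \<beta> else 0))" for \<beta>
  have m: "0 < m \<beta>" "q \<beta> \<le> m \<beta>" "N \<beta> \<le> m \<beta>" "m \<beta> \<le> q \<beta> + \<delta>" if "\<beta> \<in> S" for \<beta>
    using q[OF that] dev[OF that] by (auto simp: m_def q_def)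
  have le1: "(\<Sum>i\<in>UNIV. z \<beta> i) / m \<beta> \<le> 1" if "\<beta> \<in> S" for \<beta>
    using z(2)[OF that] m[OF that] by simp
  have y: "y \<beta> \<in> alloc_simplex" if "\<beta> \<in> S" for \<beta>
    using le1[OF that] z(1)[OF that] m(1)[OF that]
    by (auto simp: alloc_simplex_def y_def sum.distrib sum_divide_distrib)
  \<comment> \<open>The loss is at most \<open>m \<beta> - q \<beta>\<close> times the share
    \<open>z \<beta> i / m \<beta>\<close>, which is at most 1.\<close>
  have ylow: "z \<beta> i - \<delta> \<le> q \<beta> * y \<beta> $ i" if "\<beta> \<in> S" for \<beta> i
  proof -
    have "z \<beta> i \<le> (\<Sum>i\<in>UNIV. z \<beta> i)" using z(1)[OF that] by (intro member_le_sum) auto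
    hence "z \<beta> i / m \<beta> \<le> 1" using z(2)[OF that] m[OF that] by simp
    hence "(m \<beta> - q \<beta>) * (z \<beta> i / m \<beta>) \<le> (m \<beta> - q \<beta>) * 1"
      using m(2)[OF that] by (intro mult_left_mono) auto
    hence "(m \<beta> - q \<beta>) * (z \<beta> i / m \<beta>) \<le> m \<beta> - q \<beta>"
      by (simp only: mult_1_right)
    moreover have "(m \<beta> - q \<beta>) * (z \<beta> i / m \<beta>) = z \<beta> i - q \<beta> * (z \<beta> i / m \<beta>)"
      using m(1)[OF that] by (simp add: left_diff_distrib diff_divide_distrib)
    ultimately have "z \<beta> i - \<delta> \<le> q \<beta> * (z \<beta> i / m \<beta>)"
      using m(4)[OF that] by linarith
    also have "\<dots> \<le> q \<beta> * y \<beta> $ i"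
      using le1[OF that] q[OF that] by (intro mult_left_mono) (auto simp: y_def)
    finally show ?thesis .
  qed
  have "w - real (card S) * \<delta> \<le> B $ i + (\<Sum>\<beta>\<in>S. \<beta> $ i * (q \<beta> * y \<beta> $ i))" for i
  proof -
    have "(\<Sum>\<beta>\<in>S. \<beta> $ i * z \<beta> i) - real (card S) * \<delta> = (\<Sum>\<beta>\<in>S. \<beta> $ i * z \<beta> i - \<delta>)"
      by (simp add: sum_subtractf)
    also have "\<dots> \<le> (\<Sum>\<beta>\<in>S. \<beta> $ i * (q \<beta> * y \<beta> $ i))"
    proof (intro sum_mono)
      fix \<beta> assume "\<beta> \<in> S"
      have "\<beta> $ i * \<delta> \<le> 1 * \<delta>"
        using \<beta>01[OF \<open>\<beta> \<in> S\<close>] m(2,4)[OF \<open>\<beta> \<in> S\<close>] by (intro mult_right_mono) auto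
      moreover have "\<beta> $ i * (z \<beta> i - \<delta>) \<le> \<beta> $ i * (q \<beta> * y \<beta> $ i)"
        using \<beta>01[OF \<open>\<beta> \<in> S\<close>] ylow[OF \<open>\<beta> \<in> S\<close>] by (intro mult_left_mono) auto
      ultimately show "\<beta> $ i * z \<beta> i - \<delta> \<le> \<beta> $ i * (q \<beta> * y \<beta> $ i)"
        by (simp add: right_diff_distrib)
    qed
    finally show ?thesis using z(3)[of i] by linarith
  qed
  hence "w - real (card S) * \<delta> \<le> fluid_obj P T t B y"
    unfolding obj by (intro Min.boundedI) auto
  also have "\<dots> \<le> fluid_obj P T t B \<xi>"
    using assms(3) y by (auto simp: fluid_optimal_def is_arg_max_linorder S_def)
  finally have opt: "w - real (card S) * \<delta> \<le> fluid_obj P T t B \<xi>" .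
  have "w - real (card S) * \<delta> \<le> B $ i + (\<Sum>\<beta>\<in>S. \<beta> $ i * (q \<beta> * \<xi> \<beta> $ i))" for i
    using opt unfolding obj by (rule order_trans) (rule Min_le, auto)
  moreover have "0 \<le> q \<beta> * \<xi> \<beta> $ i" "(\<Sum>i\<in>UNIV. q \<beta> * \<xi> \<beta> $ i) \<le> q \<beta>" if "\<beta> \<in> S" for \<beta> i
    using \<xi>[OF that] q[OF that] by (auto simp: alloc_simplex_def sum_distrib_left[symmetric])
  ultimately show ?thesis
    unfolding q_def by (intro is_planI)
qed

section \<open>Thresholded allocations\<close>

lemma threshold_alloc_simplex:
  assumes "x \<in> alloc_simplex"
  shows "(\<Sum>i\<in>UNIV. threshold_alloc \<gamma> j x $ i) = 1"
proof -
  have "(\<Sum>i\<in>UNIV. threshold_alloc \<gamma> j x $ i) =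
      threshold_alloc \<gamma> j x $ j + (\<Sum>i\<in>UNIV - {j}. threshold_alloc \<gamma> j x $ i)"
    by (simp add: sum.remove)
  thus ?thesis by (simp add: threshold_alloc_def Let_def)
qed

text \<open>Agent \<open>j\<close> collects what is cut from the others, each of whom loses at most
  \<open>\<gamma>\<close>.\<close>

lemma threshold_alloc_self_le:
  fixes x :: "real ^ 'n::finite"
  assumes "x \<in> alloc_simplex" "0 \<le> \<gamma>"
  shows "x $ j \<le> threshold_alloc \<gamma> j x $ j" "threshold_alloc \<gamma> j x $ j \<le> 1"
    "threshold_alloc \<gamma> j x $ j \<le> x $ j + real CARD('n) * \<gamma>"
proof -
  define y where "y i = (if x $ i \<ge> \<gamma> then x $ i else 0)" for i
  have x: "0 \<le> x $ i" for i using assms by (simp add: alloc_simplex_def)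
  have eq: "threshold_alloc \<gamma> j x $ j = 1 - (\<Sum>i\<in>UNIV - {j}. y i)"
    by (simp add: threshold_alloc_def Let_def y_def)
  have one: "x $ j + (\<Sum>i\<in>UNIV - {j}. x $ i) = 1"
    using assms by (simp add: alloc_simplex_def sum.remove[of UNIV j])
  have "(\<Sum>i\<in>UNIV - {j}. y i) \<le> (\<Sum>i\<in>UNIV - {j}. x $ i)"
    using x by (intro sum_mono) (auto simp: y_def)
  thus "x $ j \<le> threshold_alloc \<gamma> j x $ j" using eq one by linarith
  have "0 \<le> (\<Sum>i\<in>UNIV - {j}. y i)" using x by (intro sum_nonneg) (auto simp: y_def)
  thus "threshold_alloc \<gamma> j x $ j \<le> 1" using eq by linarith
  have "(\<Sum>i\<in>UNIV - {j}. x $ i) \<le> (\<Sum>i\<in>UNIV - {j}. y i + \<gamma>)"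
    using assms by (intro sum_mono) (auto simp: y_def)
  also have "\<dots> = (\<Sum>i\<in>UNIV - {j}. y i) + real (card (UNIV - {j})) * \<gamma>"
    by (simp add: sum.distrib)
  also have "real (card (UNIV - {j})) * \<gamma> \<le> real CARD('n) * \<gamma>"
    using assms by (intro mult_right_mono) (auto intro: card_mono)
  finally show "threshold_alloc \<gamma> j x $ j \<le> x $ j + real CARD('n) * \<gamma>"
    using eq one by linarith
qed

lemma max_share_ge:
  fixes x :: "real ^ 'n::finite"
  assumes "x \<in> alloc_simplex" "is_arg_max (\<lambda>i. x $ i) (\<lambda>_. True) j"
  shows "1 / real CARD('n) \<le> x $ j"
proof -
  have "1 = (\<Sum>i\<in>UNIV. x $ i)" using assms by (simp add: alloc_simplex_def)
  also have "\<dots> \<le> (\<Sum>i\<in>(UNIV::'n set). x $ j)"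
    using assms(2) by (intro sum_mono) (auto simp: is_arg_max_linorder)
  finally show ?thesis by (simp add: field_simps)
qed

text \<open>For one type, \<open>M\<close> is the number of arrivals in the epoch,
  \<open>\<tau>\<close> and \<open>\<tau>'\<close> are the times remaining at its start and end, and
  \<open>z\<close> is what a plan near the fluid solution gives agent \<open>i\<close>. A share that
  is kept reserves at least \<open>\<tau>' * p * \<gamma>\<close> for later, which pays for the
  deviations; a share that is cut hands out nothing.\<close>

lemma epoch_share_le:
  fixes x :: "real ^ 'n::finite"
  assumes x: "x \<in> alloc_simplex" and j: "is_arg_max (\<lambda>i. x $ i) (\<lambda>_. True) j"
    and \<tau>: "0 < \<tau>'" "\<tau>' \<le> \<tau>" and \<gamma>: "\<gamma> = \<tau>' / (2 * (real CARD('n))\<^sup>2 * \<tau>)"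
    and p: "0 \<le> p" and M: "0 \<le> M" "M \<le> (\<tau> - \<tau>') * p + 2 * \<delta>" and "0 \<le> \<delta>"
    and z: "0 \<le> z" "\<tau> * p * x $ i - D * \<delta> \<le> z"
    and small: "(D + 2) * \<delta> \<le> \<tau>' * p * \<gamma>"
  shows "M * threshold_alloc \<gamma> j x $ i \<le> z"
proof -
  define n where "n = real CARD('n)"
  have n: "1 \<le> n" by (simp add: n_def Suc_leI)
  have \<gamma>0: "0 \<le> \<gamma>" using \<gamma> \<tau> by simp
  have \<tau>\<gamma>: "\<tau> * \<gamma> * n = \<tau>' / (2 * n)" using \<tau> n by (simp add: \<gamma> n_def[symmetric] power2_eq_square)
  have x0: "0 \<le> x $ i" using x by (simp add: alloc_simplex_def)
  \<comment> \<open>The slack \<open>(D + 2) * \<delta>\<close> covers an excess of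
    \<open>2 * \<delta>\<close> arrivals and the distance \<open>D * \<delta>\<close> of the plan
    from the fluid solution.\<close>
  have share: "M * s \<le> z"
    if s: "0 \<le> s" "s \<le> 1" and le: "(\<tau> - \<tau>') * p * s + (D + 2) * \<delta> \<le> \<tau> * p * x $ i" for s
  proof -
    have "M * s \<le> ((\<tau> - \<tau>') * p + 2 * \<delta>) * s" using M s by (intro mult_right_mono) auto
    also have "\<dots> = (\<tau> - \<tau>') * p * s + 2 * \<delta> * s" by (simp add: distrib_right)
    also have "2 * \<delta> * s \<le> 2 * \<delta> * 1" using s \<open>0 \<le> \<delta>\<close> by (intro mult_left_mono) auto
    finally show ?thesis using le z by (simp add: algebra_simps)
  qed
  show ?thesis
  proof (cases "i = j")
    case True
    have \<gamma>1: "\<gamma> \<le> 1 / (2 * n)"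
    proof -
      have "\<gamma> = (\<tau>' / \<tau>) * (1 / (2 * n)) * (1 / n)"
        by (simp add: \<gamma> n_def power2_eq_square)
      also have "\<dots> \<le> 1 * (1 / (2 * n)) * 1"
        using \<tau> n by (intro mult_mono) auto
      finally show ?thesis by simp
    qed
    have sj: "0 \<le> threshold_alloc \<gamma> j x $ j"
      using threshold_alloc_self_le(1)[OF x \<gamma>0, of j] x by (auto simp: alloc_simplex_def intro: order_trans)
    have "(\<tau> - \<tau>') * p * threshold_alloc \<gamma> j x $ j \<le> (\<tau> - \<tau>') * p * (x $ j + n * \<gamma>)"
      unfolding n_def using \<tau> p threshold_alloc_self_le[OF x \<gamma>0, of j] by (intro mult_left_mono) auto
    also have "\<dots> = \<tau> * p * x $ j + p * (\<tau> * \<gamma> * n) - \<tau>' * p * (x $ j + n * \<gamma>)"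
      by (simp add: algebra_simps)
    \<comment> \<open>By the choice of \<open>\<gamma>\<close>, collecting the cut shares costs
      \<open>j\<close> at most \<open>\<tau>' * p / (2 * n)\<close>, half of the reserve
      \<open>\<tau>' * p / n\<close> due to its share of at least \<open>1 / n\<close>.\<close>
    also have "\<tau>' * p * (1 / n) \<le> \<tau>' * p * (x $ j + n * \<gamma>)"
      using \<tau> p max_share_ge[OF x j] n \<gamma>0 unfolding n_def by (intro mult_left_mono) (auto intro: add_increasing2)
    hence "\<tau> * p * x $ j + p * (\<tau> * \<gamma> * n) - \<tau>' * p * (x $ j + n * \<gamma>)
       \<le> \<tau> * p * x $ j + p * (\<tau> * \<gamma> * n) - \<tau>' * p * (1 / n)" by simp
    also have "\<dots> = \<tau> * p * x $ j - \<tau>' * p * (1 / (2 * n))"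
      unfolding \<tau>\<gamma> using n by (simp add: field_simps)
    also have "\<dots> \<le> \<tau> * p * x $ j - \<tau>' * p * \<gamma>"
      using \<gamma>1 \<tau> p by (intro diff_left_mono mult_left_mono) auto
    finally show ?thesis
      using share[OF sj threshold_alloc_self_le(2)[OF x \<gamma>0]] small True by simp
  next
    case False
    show ?thesis
    proof (cases "\<gamma> \<le> x $ i")
      case True
      have "x $ i \<le> (\<Sum>i\<in>UNIV. x $ i)"
        using x by (intro member_le_sum) (auto simp: alloc_simplex_def)
      hence "x $ i \<le> 1" using x by (simp add: alloc_simplex_def)
      moreover have "\<tau>' * p * \<gamma> \<le> \<tau>' * p * x $ i"
        using True \<tau> p by (intro mult_left_mono) auto
      ultimately have "M * x $ i \<le> z"
        using small x0 by (intro share) (auto simp: algebra_simps)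
      thus ?thesis using True False by (simp add: threshold_alloc_def Let_def)
    next
      case below: False
      thus ?thesis using False z by (simp add: threshold_alloc_def Let_def)
    qed
  qed
qed

text \<open>Deviations within the tolerance \<open>\<delta>\<close> cost nothing: a target
  \<open>w\<close> attainable at \<open>t\<close> stays attainable at \<open>t'\<close>. Here
  \<open>N\<close> and \<open>N'\<close> are the counts remaining after \<open>t\<close> and
  \<open>t'\<close>. A predicate of \<open>c\<close> fixes one constant for all horizons and
  epochs.\<close>

definition absorbs :: "(real ^ 'n::finite) pmf \<Rightarrow> real \<Rightarrow> bool" where
  "absorbs P c \<longleftrightarrow> (\<forall>T t t' B B' \<xi> j N N' w \<gamma> y \<delta>.
     t \<le> t' \<longrightarrow> t' < T \<longrightarrow> fluid_optimal P T t B \<xi> \<longrightarrow>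
     (\<forall>\<beta>\<in>set_pmf P. is_arg_max (\<lambda>i. \<xi> \<beta> $ i) (\<lambda>_. True) (j \<beta>)) \<longrightarrow>
     \<gamma> = (real T - real t') / (2 * (real CARD('n))\<^sup>2 * (real T - real t)) \<longrightarrow>
     (\<forall>\<beta>\<in>set_pmf P. N' \<beta> \<le> N \<beta>) \<longrightarrow>
     (\<forall>i. B' $ i = B $ i +
        (\<Sum>\<beta>\<in>set_pmf P. (N \<beta> - N' \<beta>) * (\<beta> $ i * threshold_alloc \<gamma> (j \<beta>) (\<xi> \<beta>) $ i))) \<longrightarrow>
     \<delta> = c * (real T - real t')\<^sup>2 / (real T - real t) \<longrightarrow>
     (\<forall>\<beta>\<in>set_pmf P. \<bar>N \<beta> - (real T - real t) * pmf P \<beta>\<bar> \<le> \<delta>) \<longrightarrow>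
     (\<forall>\<beta>\<in>set_pmf P. \<bar>N' \<beta> - (real T - real t') * pmf P \<beta>\<bar> \<le> \<delta>) \<longrightarrow>
     is_plan (set_pmf P) B N w y \<longrightarrow>
     (\<exists>z. is_plan (set_pmf P) B' N' w z))"

text \<open>Stability moves the fluid solution to a plan \<open>z\<close> for the actual counts;
  \<open>z\<close> dominates what the epoch hands out, so subtracting this leaves a plan for the
  remaining counts.\<close>

lemma absorbs_exists:
  fixes P :: "(real ^ 'n::finite) pmf"
  assumes adm: "admissible P"
  shows "\<exists>c>0. absorbs P c"
proof -
  define S where "S = set_pmf P"
  have finS: "finite S" using adm by (simp add: admissible_def S_def)
  have neS: "S \<noteq> {}" by (simp add: S_def set_pmf_not_empty)
  have card1: "1 \<le> real (card S)" using finS neS by (simp add: Suc_leI card_gt_0_iff)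
  obtain \<kappa> where \<kappa>: "0 \<le> \<kappa>" and stab: "\<And>B N w \<epsilon> x y. 0 \<le> \<epsilon> \<Longrightarrow> is_plan S B N w y \<Longrightarrow>
           is_plan S B (\<lambda>\<beta>. N \<beta> + \<epsilon>) (w - \<epsilon>) x \<Longrightarrow>
           (\<exists>z. is_plan S B N w z \<and> (\<forall>\<beta>\<in>S. \<forall>i. \<bar>z \<beta> i - x \<beta> i\<bar> \<le> \<kappa> * \<epsilon>))"
    using plan_stability[OF finS] by metis
  define D where "D = \<kappa> * real (card S)"
  define pmin where "pmin = Min (pmf P ` S)"
  define n where "n = real CARD('n)"
  have n: "0 < n" by (simp add: n_def)
  have pmin: "0 < pmin" "\<And>\<beta>. \<beta> \<in> S \<Longrightarrow> pmin \<le> pmf P \<beta>"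
    using finS neS by (auto simp: pmin_def S_def pmf_positive)
  have D0: "0 \<le> D" using \<kappa> by (simp add: D_def)
  \<comment> \<open>Chosen so that the slack \<open>(D + 2) * \<delta>\<close> equals
    \<open>pmin * \<tau>' * \<gamma>\<close>, the reserve guaranteed for the rarest type.\<close>
  define c where "c = pmin / (2 * n\<^sup>2 * (D + 2))"
  have c0: "0 < c" using pmin n D0 by (simp add: c_def)
  show ?thesis
    unfolding absorbs_def S_def[symmetric]
  proof (intro exI[of _ c] conjI allI impI)
    fix T t t' :: nat and B B' :: "real ^ 'n" and \<xi> :: "real ^ 'n \<Rightarrow> real ^ 'n" and j
      and N N' :: "real ^ 'n \<Rightarrow> real" and w \<gamma> \<delta> :: real and y
    assume t: "t \<le> t'" "t' < T" and opt: "fluid_optimal P T t B \<xi>"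
      and j: "\<forall>\<beta>\<in>S. is_arg_max (\<lambda>i. \<xi> \<beta> $ i) (\<lambda>_. True) (j \<beta>)"
      and \<gamma>: "\<gamma> = (real T - real t') / (2 * (real CARD('n))\<^sup>2 * (real T - real t))"
      and NN: "\<forall>\<beta>\<in>S. N' \<beta> \<le> N \<beta>"
      and B': "\<forall>i. B' $ i = B $ i +
         (\<Sum>\<beta>\<in>S. (N \<beta> - N' \<beta>) * (\<beta> $ i * threshold_alloc \<gamma> (j \<beta>) (\<xi> \<beta>) $ i))"
      and \<delta>: "\<delta> = c * (real T - real t')\<^sup>2 / (real T - real t)"
      and N: "\<forall>\<beta>\<in>S. \<bar>N \<beta> - (real T - real t) * pmf P \<beta>\<bar> \<le> \<delta>"
      and N': "\<forall>\<beta>\<in>S. \<bar>N' \<beta> - (real T - real t') * pmf P \<beta>\<bar> \<le> \<delta>"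
      and y: "is_plan S B N w y"
    define \<tau> where "\<tau> = real T - real t"
    define \<tau>' where "\<tau>' = real T - real t'"
    have \<tau>: "0 < \<tau>'" "\<tau>' \<le> \<tau>" using t by (auto simp: \<tau>_def \<tau>'_def)
    have \<delta>0: "0 \<le> \<delta>" using c0 \<tau> unfolding \<delta> \<tau>_def[symmetric] \<tau>'_def[symmetric] by simp
    \<comment> \<open>One \<open>\<epsilon>\<close> relaxes both targets and supplies: the fluid
      solution misses the target by up to \<open>card S * \<delta>\<close>, and each count is off by
      up to \<open>\<delta> \<le> \<epsilon>\<close>.\<close>
    define \<epsilon> where "\<epsilon> = real (card S) * \<delta>"
    have \<epsilon>: "0 \<le> \<epsilon>" "\<delta> \<le> \<epsilon>"
      using \<delta>0 mult_right_mono[OF card1 \<delta>0] by (auto simp: \<epsilon>_def)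
    have "is_plan S B (\<lambda>\<beta>. \<tau> * pmf P \<beta>) (w - \<epsilon>) (\<lambda>\<beta> i. \<tau> * pmf P \<beta> * \<xi> \<beta> $ i)"
      unfolding \<tau>_def \<epsilon>_def S_def
      by (rule fluid_near_optimal[OF adm opt _ y[unfolded S_def]]) (use t N in \<open>auto simp: S_def\<close>)
    hence "is_plan S B (\<lambda>\<beta>. N \<beta> + \<epsilon>) (w - \<epsilon>) (\<lambda>\<beta> i. \<tau> * pmf P \<beta> * \<xi> \<beta> $ i)"
      using N \<epsilon>(2) unfolding is_plan_def \<tau>_def by fastforce
    from stab[OF \<epsilon>(1) y this] obtain z where z: "is_plan S B N w z"
      and close: "\<And>\<beta> i. \<beta> \<in> S \<Longrightarrow> \<bar>z \<beta> i - \<tau> * pmf P \<beta> * \<xi> \<beta> $ i\<bar> \<le> D * \<delta>"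
      by (auto simp: D_def \<epsilon>_def mult.assoc)
    note zp = is_planD[OF z]
    define a where "a \<beta> = threshold_alloc \<gamma> (j \<beta>) (\<xi> \<beta>)" for \<beta>
    have \<xi>: "\<beta> \<in> S \<Longrightarrow> \<xi> \<beta> \<in> alloc_simplex" for \<beta>
      using opt by (auto simp: fluid_optimal_def is_arg_max_def S_def)
    have absorb: "(N \<beta> - N' \<beta>) * a \<beta> $ i \<le> z \<beta> i" if \<beta>: "\<beta> \<in> S" for \<beta> i
      unfolding a_def
    proof (rule epoch_share_le[where \<tau> = \<tau> and \<tau>' = \<tau>' and p = "pmf P \<beta>" and D = D and \<delta> = \<delta>])
      show "N \<beta> - N' \<beta> \<le> (\<tau> - \<tau>') * pmf P \<beta> + 2 * \<delta>"
        using bspec[OF N \<beta>] bspec[OF N' \<beta>] unfolding \<tau>_def[symmetric] \<tau>'_def[symmetric]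
        by (simp add: left_diff_distrib)
      have "(D + 2) * \<delta> = pmin * (\<tau>' * \<gamma>)"
      proof -
        have "(D + 2) * c = pmin / (2 * n\<^sup>2)" using D0 by (simp add: c_def)
        hence "(D + 2) * \<delta> = pmin / (2 * n\<^sup>2) * (\<tau>'\<^sup>2 / \<tau>)"
          unfolding \<delta> \<tau>_def[symmetric] \<tau>'_def[symmetric]
          by (simp only: mult.assoc[symmetric] times_divide_eq_right[symmetric])
        also have "\<dots> = pmin * (\<tau>' * \<gamma>)"
          unfolding \<gamma> \<tau>_def[symmetric] \<tau>'_def[symmetric] n_def[symmetric]
          by (simp add: power2_eq_square)
        finally show ?thesis .
      qed
      also have "\<dots> \<le> pmf P \<beta> * (\<tau>' * \<gamma>)"
        using pmin(2)[OF \<beta>] \<tau> n unfolding \<gamma> \<tau>_def[symmetric] \<tau>'_def[symmetric] n_def[symmetric]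
        by (intro mult_right_mono) auto
      finally show "(D + 2) * \<delta> \<le> \<tau>' * pmf P \<beta> * \<gamma>" by (simp add: mult_ac)
      show "\<tau> * pmf P \<beta> * \<xi> \<beta> $ i - D * \<delta> \<le> z \<beta> i" using close[OF \<beta>, of i] by linarith
    qed (use \<xi> j \<beta> \<tau> \<gamma> NN \<delta>0 zp in \<open>auto simp: \<tau>_def \<tau>'_def\<close>)
    have "is_plan S B' N' w (\<lambda>\<beta> i. z \<beta> i - (N \<beta> - N' \<beta>) * a \<beta> $ i)"
    proof (rule is_planI)
      fix \<beta> assume \<beta>: "\<beta> \<in> S"
      have "(\<Sum>i\<in>UNIV. z \<beta> i - (N \<beta> - N' \<beta>) * a \<beta> $ i) = (\<Sum>i\<in>UNIV. z \<beta> i) - (N \<beta> - N' \<beta>)"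
        using threshold_alloc_simplex[OF \<xi>[OF \<beta>]]
        by (simp add: sum_subtractf sum_distrib_left[symmetric] a_def)
      thus "(\<Sum>i\<in>UNIV. z \<beta> i - (N \<beta> - N' \<beta>) * a \<beta> $ i) \<le> N' \<beta>"
        using zp(2)[OF \<beta>] by linarith
    next
      fix i
      have "B' $ i + (\<Sum>\<beta>\<in>S. \<beta> $ i * (z \<beta> i - (N \<beta> - N' \<beta>) * a \<beta> $ i)) =
          B $ i + (\<Sum>\<beta>\<in>S. \<beta> $ i * z \<beta> i)"
        using B' by (simp add: a_def right_diff_distrib sum_subtractf mult_ac)
      thus "w \<le> B' $ i + (\<Sum>\<beta>\<in>S. \<beta> $ i * (z \<beta> i - (N \<beta> - N' \<beta>) * a \<beta> $ i))"
        using zp(3) by simp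
    qed (use absorb in auto)
    thus "\<exists>z. is_plan S B' N' w z" by blast
  qed (rule c0)
qed

subsection \<open>Concentration and the epoch schedule\<close>

text \<open>Identifies each count as binomial, so that Hoeffding's inequality for the binomial
  distribution applies.\<close>

lemma map_count_replicate_pmf:
  "map_pmf (\<lambda>xs. count_list xs a) (replicate_pmf n P) = binomial_pmf n (pmf P a)"
proof (induction n)
  case (Suc n)
  have coin: "map_pmf (\<lambda>x. x = a) P = bernoulli_pmf (pmf P a)"
  proof (rule pmf_eqI)
    fix b
    have "pmf (map_pmf (\<lambda>x. x = a) P) True = pmf P a"
      by (simp add: pmf_map vimage_def measure_pmf_single)
    moreover from this have "pmf (map_pmf (\<lambda>x. x = a) P) False = 1 - pmf P a"
      by (simp add: pmf_False_conv_True)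
    ultimately show "pmf (map_pmf (\<lambda>x. x = a) P) b = pmf (bernoulli_pmf (pmf P a)) b"
      by (cases b) (simp_all add: pmf_le_1)
  qed
  thus ?case
    by (simp add: binomial_pmf_Suc pmf_le_1 Suc.IH[symmetric] map_pmf_def bind_assoc_pmf
        bind_return_pmf flip: coin)
      (intro bind_pmf_cong refl, auto)
qed (simp add: binomial_pmf_0 pmf_le_1)

lemma map_drop_replicate_pmf:
  assumes "t \<le> n"
  shows "map_pmf (drop t) (replicate_pmf n P) = replicate_pmf (n - t) P"
proof -
  have "map_pmf (drop t) (replicate_pmf (t + (n - t)) P) =
      bind_pmf (replicate_pmf t P) (\<lambda>xs. bind_pmf (replicate_pmf (n - t) P) (\<lambda>ys. return_pmf (drop t (xs @ ys))))"
    unfolding replicate_pmf_distrib by (simp add: map_bind_pmf)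
  also have "\<dots> = bind_pmf (replicate_pmf t P) (\<lambda>xs. bind_pmf (replicate_pmf (n - t) P) return_pmf)"
    by (intro bind_pmf_cong refl) (auto simp: set_replicate_pmf)
  finally show ?thesis using assms by (simp add: bind_return_pmf')
qed

text \<open>A suffix of an i.i.d. sequence is i.i.d., so its counts are binomial and
  \<open>prob_abs_ge\<close> is Hoeffding's bound.\<close>

lemma prob_suffix_count_deviates:
  assumes "t < T" "0 \<le> \<delta>"
  shows "measure_pmf.prob (replicate_pmf T P)
           {bs. \<delta> < \<bar>real (count_list (drop t bs) a) - (real T - real t) * pmf P a\<bar>}
         \<le> 2 * exp (- 2 * \<delta>\<^sup>2 / (real T - real t))"
proof -
  interpret binomial_distribution "T - t" "pmf P a"
    using assms by unfold_locales (auto simp: pmf_le_1)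
  have "measure_pmf.prob (replicate_pmf T P)
           {bs. \<delta> < \<bar>real (count_list (drop t bs) a) - (real T - real t) * pmf P a\<bar>} =
        measure_pmf.prob (binomial_pmf (T - t) (pmf P a)) {x. \<delta> < \<bar>real x - (real T - real t) * pmf P a\<bar>}"
    unfolding map_count_replicate_pmf[symmetric]
    using map_drop_replicate_pmf[of t T P, symmetric] assms
    by (simp add: vimage_def)
  also have "\<dots> \<le> measure_pmf.prob (binomial_pmf (T - t) (pmf P a)) {x. \<bar>real x - real (T - t) * pmf P a\<bar> \<ge> \<delta>}"
    using assms by (intro measure_pmf.finite_measure_mono) (auto simp: of_nat_diff)
  also have "\<dots> \<le> 2 * exp (- 2 * \<delta>\<^sup>2 / real (T - t))"
    by (rule prob_abs_ge) (use assms in auto)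
  finally show ?thesis using assms by (simp add: of_nat_diff)
qed

text \<open>With \<open>y = \<eta> ^ m\<close>, the term \<open>c * exp (\<theta> * y)\<close>
  dominates a multiple of \<open>y\<^sup>2\<close> and hence outweighs \<open>\<eta> * y\<close>;
  Bernoulli's inequality for \<open>y\<close> then yields a geometric majorant.\<close>

lemma summable_epoch_costs:
  fixes \<eta> \<theta> c :: real
  assumes "1 < \<eta>" "0 < \<theta>" "0 < c"
  shows "summable (\<lambda>m. exp (\<eta> ^ Suc m - c * exp (\<theta> * \<eta> ^ m)))"
proof -
  define a where "a = c * \<theta>\<^sup>2 / 2"
  define C where "C = (\<eta> + 1)\<^sup>2 / (4 * a)"
  have a: "0 < a" using assms by (simp add: a_def)
  have bound: "exp (\<eta> ^ Suc m - c * exp (\<theta> * \<eta> ^ m)) \<le> exp C * exp (- (\<eta> - 1)) ^ m" for m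
  proof -
    define y where "y = \<eta> ^ m"
    have y: "1 + real m * (\<eta> - 1) \<le> y" "1 \<le> y"
      using Bernoulli_inequality[of "\<eta> - 1" m] assms by (auto simp: y_def)
    have "(\<theta> * y)\<^sup>2 / 2 \<le> exp (\<theta> * y)"
    proof -
      have "0 \<le> \<theta> * y" using assms y by simp
      thus ?thesis using exp_lower_Taylor_quadratic[of "\<theta> * y"] by linarith
    qed
    hence "c * ((\<theta> * y)\<^sup>2 / 2) \<le> c * exp (\<theta> * y)" using assms by (intro mult_left_mono) auto
    hence 1: "a * y\<^sup>2 \<le> c * exp (\<theta> * y)" by (simp add: a_def power_mult_distrib mult_ac)
    \<comment> \<open>Completing the square for \<open>\<eta> + 1\<close> instead of
      \<open>\<eta>\<close> leaves a spare \<open>- y\<close>, which produces the geometric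
      decay.\<close>
    have "0 \<le> a * (y - (\<eta> + 1) / (2 * a))\<^sup>2" using a by simp
    also have "\<dots> = a * y\<^sup>2 - (\<eta> + 1) * y + C"
      using a by (simp add: C_def power2_eq_square field_simps)
    finally have "\<eta> * y - c * exp (\<theta> * y) \<le> C - real m * (\<eta> - 1)"
      using 1 y by (simp add: algebra_simps)
    hence "exp (\<eta> ^ Suc m - c * exp (\<theta> * \<eta> ^ m)) \<le> exp (C - real m * (\<eta> - 1))"
      by (simp add: y_def)
    also have "\<dots> = exp C * exp (- (\<eta> - 1)) ^ m"
      unfolding exp_of_nat_mult[symmetric] exp_add[symmetric] by (simp add: right_diff_distrib)
    finally show ?thesis .
  qed
  have "summable (\<lambda>m. exp C * exp (- (\<eta> - 1)) ^ m)"
    using assms by (intro summable_mult summable_geometric) simp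
  thus ?thesis
    by (rule summable_comparison_test') (use bound in \<open>simp only: real_norm_def abs_exp_cancel\<close>)
qed

section \<open>Lengths of the epochs\<close>

lemma horizon_le_exp:
  assumes "1 < \<eta>" "3 \<le> T"
  shows "real T \<le> exp (\<eta> ^ birt_K \<eta> T)"
proof -
  have lT: "1 < ln (real T)"
    using ln_ln_pos[OF assms(2)] assms(2) by (simp add: ln_gt_zero_iff)
  have "ln (ln (real T)) / ln \<eta> \<le> real (birt_K \<eta> T)"
    using birt_K_no_trunc(1)[OF assms] unfolding birt_K_def by linarith
  hence "ln (ln (real T)) \<le> real (birt_K \<eta> T) * ln \<eta>" using assms by (simp add: field_simps)
  also have "\<dots> = ln (\<eta> ^ birt_K \<eta> T)" using assms by (simp add: ln_realpow)
  finally have "ln (real T) \<le> \<eta> ^ birt_K \<eta> T" using lT assms by (subst (asm) ln_le_cancel_iff) auto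
  hence "exp (ln (real T)) \<le> exp (\<eta> ^ birt_K \<eta> T)" by simp
  thus ?thesis using assms(2) by simp
qed

definition birt_rem :: "real \<Rightarrow> nat \<Rightarrow> nat \<Rightarrow> real" where
  "birt_rem \<eta> T k = real T - real (birt_time \<eta> T k)"

lemma birt_rem_upper:
  assumes "1 < \<eta>" "3 \<le> T" "k \<le> birt_K \<eta> T"
  shows "birt_rem \<eta> T k \<le> exp (\<eta> ^ (birt_K \<eta> T - k))"
  using birt_time_no_trunc(1)[OF assms(1,2) _ assms(3)] horizon_le_exp[OF assms(1,2)]
  by (cases "k = 0") (auto simp: birt_rem_def birt_time_def)

text \<open>Rounding down loses at most 1, which is at most half of a number that is at least
  \<open>exp 1 \<ge> 2\<close>.\<close>

lemma birt_rem_lower: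
  assumes "1 < \<eta>" "3 \<le> T" "0 < k" "k \<le> birt_K \<eta> T"
  shows "exp (\<eta> ^ (birt_K \<eta> T - k)) / 2 \<le> birt_rem \<eta> T k"
proof -
  have "exp 1 \<le> exp (\<eta> ^ (birt_K \<eta> T - k))" using assms by simp
  moreover have "2 \<le> exp (1 :: real)" using exp_ge_add_one_self[of 1] by simp
  ultimately show ?thesis
    using birt_time_no_trunc(1)[OF assms] unfolding birt_rem_def by linarith
qed

lemma birt_time_mono:
  assumes "1 < \<eta>" "3 \<le> T" "k < birt_K \<eta> T"
  shows "birt_time \<eta> T k \<le> birt_time \<eta> T (Suc k)"
proof (cases "k = 0")
  case True
  thus ?thesis by (simp add: birt_time_def)
next
  case False
  have "exp (\<eta> ^ (birt_K \<eta> T - Suc k)) \<le> exp (\<eta> ^ (birt_K \<eta> T - k))"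
    using assms by (auto intro: power_increasing)
  hence "\<lfloor>exp (\<eta> ^ (birt_K \<eta> T - Suc k))\<rfloor> \<le> \<lfloor>exp (\<eta> ^ (birt_K \<eta> T - k))\<rfloor>"
    by (rule floor_mono)
  thus ?thesis
    using False assms by (auto simp: birt_time_def intro!: diff_le_mono2 nat_mono)
qed

text \<open>The exponent is \<open>\<eta> ^ 0 = 1\<close>, so at most \<open>exp 1\<close> periods
  remain.\<close>

lemma birt_rem_last:
  assumes "1 < \<eta>" "3 \<le> T"
  shows "birt_rem \<eta> T (birt_K \<eta> T) \<le> 3"
  using birt_rem_upper[OF assms order_refl] exp_le by simp

text \<open>The largest possible loss times the Hoeffding tail, with \<open>m\<close> counting
  epochs from the end. For remaining times \<open>u\<close> and \<open>v\<close>,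
  \<open>\<delta>\<^sup>2 / u = c\<^sup>2 * v ^ 4 / u ^ 3\<close>, and \<open>v ^ 4 / u ^ 3\<close>
  is at least \<open>exp ((4 - 3 * \<eta>) * \<eta> ^ m) / 16\<close>. This is the source of the
  threshold 4/3 for \<open>\<eta>\<close>.\<close>

lemma epoch_failure_cost:
  assumes "1 < \<eta>" "3 \<le> T" "k < birt_K \<eta> T" "0 < c"
  defines "m \<equiv> birt_K \<eta> T - Suc k"
  defines "\<delta> \<equiv> c * (birt_rem \<eta> T (Suc k))\<^sup>2 / birt_rem \<eta> T k"
  shows "birt_rem \<eta> T k * exp (- 2 * \<delta>\<^sup>2 / birt_rem \<eta> T k)
         \<le> exp (\<eta> ^ Suc m - c\<^sup>2 / 8 * exp ((4 - 3 * \<eta>) * \<eta> ^ m))"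
proof -
  define u where "u = birt_rem \<eta> T k"
  define v where "v = birt_rem \<eta> T (Suc k)"
  have Sm: "birt_K \<eta> T - k = Suc m" using assms by (simp add: m_def)
  have u: "u \<le> exp (\<eta> ^ Suc m)"
    using birt_rem_upper[OF assms(1,2), of k] assms(3) unfolding u_def Sm by simp
  have v: "exp (\<eta> ^ m) / 2 \<le> v"
    using birt_rem_lower[OF assms(1,2), of "Suc k"] assms(3) unfolding v_def m_def by simp
  have "v \<le> u" using birt_time_mono[OF assms(1-3)] by (simp add: u_def v_def birt_rem_def)
  have v0: "0 < v" using v by (rule less_le_trans[rotated]) simp
  have u0: "0 < u" using v0 \<open>v \<le> u\<close> by simp
  have "exp ((4 - 3 * \<eta>) * \<eta> ^ m) / 16 = (exp (\<eta> ^ m) / 2) ^ 4 / exp (\<eta> ^ Suc m) ^ 3"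
    by (simp add: power_divide exp_of_nat_mult[symmetric] exp_diff[symmetric] algebra_simps)
  also have "\<dots> \<le> v ^ 4 / u ^ 3"
    using u v u0 by (intro frac_le power_mono) auto
  finally have "c\<^sup>2 / 8 * exp ((4 - 3 * \<eta>) * \<eta> ^ m) \<le> 2 * c\<^sup>2 * (v ^ 4 / u ^ 3)"
    using mult_left_mono[of "exp ((4 - 3 * \<eta>) * \<eta> ^ m) / 16" "v ^ 4 / u ^ 3" "2 * c\<^sup>2"] by simp
  also have "\<dots> = 2 * \<delta>\<^sup>2 / u"
  proof -
    have "\<delta>\<^sup>2 = c\<^sup>2 * v ^ 4 / u\<^sup>2"
      unfolding \<delta>_def u_def[symmetric] v_def[symmetric]
      by (simp add: power_divide power_mult_distrib flip: power_mult)
    thus ?thesis by (simp add: power2_eq_square power3_eq_cube)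
  qed
  finally have "exp (- 2 * \<delta>\<^sup>2 / u) \<le> exp (- (c\<^sup>2 / 8 * exp ((4 - 3 * \<eta>) * \<eta> ^ m)))" by simp
  hence "u * exp (- 2 * \<delta>\<^sup>2 / u) \<le> exp (\<eta> ^ Suc m) * exp (- (c\<^sup>2 / 8 * exp ((4 - 3 * \<eta>) * \<eta> ^ m)))"
    using u u0 by (intro mult_mono) auto
  thus ?thesis by (simp add: u_def exp_add[symmetric])
qed

subsection \<open>Regret along a realization and in expectation\<close>

text \<open>Each remaining arrival adds at most 1 to any agent's utility. This limits the loss after
  an atypical epoch and in the last epoch.\<close>

lemma plan_target_le:
  fixes P :: "(real ^ 'n::finite) pmf"
  assumes "admissible P" "is_plan (set_pmf P) B N w z"
  shows "w \<le> B $ i + (\<Sum>\<beta>\<in>set_pmf P. N \<beta>)"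
proof -
  note z = is_planD[OF assms(2)]
  have "(\<Sum>\<beta>\<in>set_pmf P. \<beta> $ i * z \<beta> i) \<le> (\<Sum>\<beta>\<in>set_pmf P. N \<beta>)"
  proof (intro sum_mono)
    fix \<beta> assume \<beta>: "\<beta> \<in> set_pmf P"
    have "\<beta> $ i * z \<beta> i \<le> z \<beta> i"
      using assms(1) z(1)[OF \<beta>] \<beta> by (intro mult_left_le_one_le) (auto simp: admissible_def)
    also have "\<dots> \<le> (\<Sum>i\<in>UNIV. z \<beta> i)" using z(1)[OF \<beta>] by (intro member_le_sum) auto
    also have "\<dots> \<le> N \<beta>" by (rule z(2)[OF \<beta>])
    finally show "\<beta> $ i * z \<beta> i \<le> N \<beta>" .
  qed
  thus ?thesis using z(3)[of i] by linarith
qed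

text \<open>The difference of two suffix counts is the count within the segment; this turns sums
  over periods into the form used in \<open>absorbs\<close>.\<close>

lemma sum_segment_by_value:
  fixes f :: "'a \<Rightarrow> real"
  assumes "finite S" "set bs \<subseteq> S" "t \<le> t'" "t' \<le> length bs"
  shows "(\<Sum>s\<in>{t..<t'}. f (bs ! s)) =
    (\<Sum>a\<in>S. (real (count_list (drop t bs) a) - real (count_list (drop t' bs) a)) * f a)"
  using assms(3,4)
proof (induction t' rule: dec_induct)
  case (step n)
  have "bs ! n \<in> S" using step assms(2) by (auto intro!: subsetD[OF assms(2)] nth_mem)
  have "drop n bs = bs ! n # drop (Suc n) bs" using step by (simp add: Cons_nth_drop_Suc)
  hence "(\<Sum>a\<in>S. (real (count_list (drop t bs) a) - real (count_list (drop (Suc n) bs) a)) * f a) =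
      (\<Sum>a\<in>S. (real (count_list (drop t bs) a) - real (count_list (drop n bs) a)) * f a
        + (if a = bs ! n then f a else 0))"
    by (intro sum.cong) (auto simp: algebra_simps)
  also have "\<dots> = (\<Sum>s\<in>{t..<n}. f (bs ! s)) + f (bs ! n)"
    using step assms(1) \<open>bs ! n \<in> S\<close> by (simp add: sum.distrib)
  finally show ?case using step by simp
qed simp

text \<open>An optimal hindsight allocation, summed over the periods of each type, is a plan for the
  full counts.\<close>

lemma hindsight_plan:
  fixes bs :: "(real ^ 'n::finite) list"
  assumes "finite S" "set bs \<subseteq> S"
  shows "\<exists>z. is_plan S 0 (\<lambda>\<beta>. real (count_list bs \<beta>)) (hindsight_opt bs) z"
proof -
  obtain x where x: "\<And>s. s < length bs \<Longrightarrow> x s \<in> alloc_simplex"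
    and opt: "hindsight_opt bs = egal_welfare (\<chi> i. \<Sum>s<length bs. bs ! s $ i * x s $ i)"
    using hindsight_opt_attained[of bs] by (auto simp: is_arg_max_def)
  define z where "z \<beta> i = (\<Sum>s\<in>{s\<in>{..<length bs}. bs ! s = \<beta>}. x s $ i)" for \<beta> i
  have "is_plan S 0 (\<lambda>\<beta>. real (count_list bs \<beta>)) (hindsight_opt bs) z"
  proof (rule is_planI)
    fix \<beta> i
    show "0 \<le> z \<beta> i" using x by (auto simp: z_def alloc_simplex_def intro!: sum_nonneg)
  next
    fix \<beta>
    have "(\<Sum>i\<in>UNIV. z \<beta> i) = (\<Sum>s\<in>{s\<in>{..<length bs}. bs ! s = \<beta>}. \<Sum>i\<in>UNIV. x s $ i)"
      unfolding z_def by (rule sum.swap)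
    also have "\<dots> = (\<Sum>s\<in>{s\<in>{..<length bs}. bs ! s = \<beta>}. 1)"
      using x by (intro sum.cong) (auto simp: alloc_simplex_def)
    also have "\<dots> = real (count_list bs \<beta>)"
      by (auto simp: count_list_eq_length_filter length_filter_conv_card intro!: arg_cong[of _ _ card])
    finally show "(\<Sum>i\<in>UNIV. z \<beta> i) \<le> real (count_list bs \<beta>)" by simp
  next
    fix i
    have "(\<Sum>\<beta>\<in>S. \<beta> $ i * z \<beta> i) =
        (\<Sum>\<beta>\<in>S. \<Sum>s\<in>{s\<in>{..<length bs}. bs ! s = \<beta>}. bs ! s $ i * x s $ i)"
      by (auto simp: z_def sum_distrib_left intro!: sum.cong)
    also have "\<dots> = (\<Sum>s<length bs. bs ! s $ i * x s $ i)"
      using assms by (intro sum.group) auto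
    finally show "hindsight_opt bs \<le> 0 $ i + (\<Sum>\<beta>\<in>S. \<beta> $ i * z \<beta> i)"
      unfolding opt egal_welfare_def by (simp add: Min_le_iff)
  qed
  thus ?thesis by blast
qed

section \<open>Utilities gained within an epoch\<close>

lemma cum_utility_take:
  assumes "t \<le> length bs"
  shows "cum_utility \<pi> (take t bs) $ i = (\<Sum>s<t. bs ! s $ i * \<pi> (take (Suc s) bs) $ i)"
  using assms by (auto simp: cum_utility_def min_def intro!: sum.cong)

lemma birt_threshold_nonneg: "0 \<le> birt_threshold TYPE('n::finite) \<eta> T k"
  by (auto simp: birt_threshold_def birt_time_def intro!: divide_nonneg_nonneg mult_nonneg_nonneg)

lemma threshold_alloc_nonneg:
  assumes "x \<in> alloc_simplex" "0 \<le> \<gamma>"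
  shows "0 \<le> threshold_alloc \<gamma> j x $ i"
proof (cases "i = j")
  case True
  have "0 \<le> x $ j" using assms by (simp add: alloc_simplex_def)
  thus ?thesis using threshold_alloc_self_le(1)[OF assms, of j] True by simp
next
  case False
  thus ?thesis using assms by (simp add: threshold_alloc_def Let_def alloc_simplex_def)
qed

text \<open>The shares are fixed by the history up to \<open>t\<close>, so the utility gained in the
  epoch depends only on the counts of the types in it.\<close>

lemma birt_epoch:
  fixes P :: "(real ^ 'n::finite) pmf"
  assumes birt: "is_BIRT P \<eta> T \<pi>" and adm: "admissible P" and k: "k \<le> birt_K \<eta> T"
    and bs: "set bs \<subseteq> set_pmf P" "length bs = T"
    and times: "birt_time \<eta> T k \<le> birt_time \<eta> T (Suc k)"
  defines "t \<equiv> birt_time \<eta> T k" and "t' \<equiv> birt_time \<eta> T (Suc k)"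
    and "\<gamma> \<equiv> birt_threshold TYPE('n) \<eta> T k"
  obtains \<xi> j where
    "fluid_optimal P T t (cum_utility \<pi> (take t bs)) \<xi>"
    "\<And>\<beta>. \<beta> \<in> set_pmf P \<Longrightarrow> is_arg_max (\<lambda>i. \<xi> \<beta> $ i) (\<lambda>_. True) (j \<beta>)"
    "\<And>i. cum_utility \<pi> (take t' bs) $ i = cum_utility \<pi> (take t bs) $ i +
       (\<Sum>\<beta>\<in>set_pmf P. (real (count_list (drop t bs) \<beta>) - real (count_list (drop t' bs) \<beta>)) *
          (\<beta> $ i * threshold_alloc \<gamma> (j \<beta>) (\<xi> \<beta>) $ i))"
    "\<And>i. cum_utility \<pi> (take t bs) $ i \<le> cum_utility \<pi> (take t' bs) $ i"
proof -
  have t: "t \<le> t'" "t' \<le> T" using times by (auto simp: t_def t'_def birt_time_def)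
  have "take t bs \<in> lists (set_pmf P)" "length (take t bs) = t"
    using bs t by (auto dest: in_set_takeD)
  then obtain \<xi> j where opt: "fluid_optimal P T t (cum_utility \<pi> (take t bs)) \<xi>"
    and j: "\<forall>\<beta>\<in>set_pmf P. is_arg_max (\<lambda>i. \<xi> \<beta> $ i) (\<lambda>_. True) (j \<beta>)"
    and act: "\<And>g. g \<in> lists (set_pmf P) \<Longrightarrow> g \<noteq> [] \<Longrightarrow> length (take t bs @ g) \<le> t' \<Longrightarrow>
       \<pi> (take t bs @ g) = threshold_alloc \<gamma> (j (last g)) (\<xi> (last g))"
    using birt k unfolding is_BIRT_def t_def t'_def \<gamma>_def by metis
  have alloc: "\<pi> (take (Suc s) bs) = threshold_alloc \<gamma> (j (bs ! s)) (\<xi> (bs ! s))"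
    if s: "t \<le> s" "s < t'" for s
  proof -
    \<comment> \<open>\<open>g\<close> is the part of the history inside the epoch; its last entry
      \<open>bs ! s\<close> is the utility vector of period \<open>s + 1\<close>.\<close>
    define g where "g = drop t (take (Suc s) bs)"
    have "take (Suc s) bs = take t (take (Suc s) bs) @ g"
      unfolding g_def by (rule append_take_drop_id[symmetric])
    also have "take t (take (Suc s) bs) = take t bs" using s by (simp add: min_def)
    finally have eq: "take (Suc s) bs = take t bs @ g" .
    have g: "g \<noteq> []" "length (take t bs @ g) \<le> t'" "last g = bs ! s" "g \<in> lists (set_pmf P)"
      using s t bs unfolding eq[symmetric]
      by (auto simp: g_def last_conv_nth dest!: in_set_dropD in_set_takeD)
    show ?thesis unfolding eq using act[OF g(4,1,2)] g(3) by simp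
  qed
  have \<xi>: "\<xi> \<beta> \<in> alloc_simplex" if "\<beta> \<in> set_pmf P" for \<beta>
    using opt that by (auto simp: fluid_optimal_def is_arg_max_def)
  have inc: "cum_utility \<pi> (take t' bs) $ i = cum_utility \<pi> (take t bs) $ i +
      (\<Sum>s\<in>{t..<t'}. bs ! s $ i * threshold_alloc \<gamma> (j (bs ! s)) (\<xi> (bs ! s)) $ i)" for i
  proof -
    have "cum_utility \<pi> (take t' bs) $ i = cum_utility \<pi> (take t bs) $ i +
        (\<Sum>s\<in>{t..<t'}. bs ! s $ i * \<pi> (take (Suc s) bs) $ i)"
      using t bs by (simp add: cum_utility_take lessThan_atLeast0 sum.atLeastLessThan_concat)
    thus ?thesis using alloc by simp
  qed
  show ?thesis
  proof (rule that[OF opt])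
    fix i
    show "cum_utility \<pi> (take t' bs) $ i = cum_utility \<pi> (take t bs) $ i +
       (\<Sum>\<beta>\<in>set_pmf P. (real (count_list (drop t bs) \<beta>) - real (count_list (drop t' bs) \<beta>)) *
          (\<beta> $ i * threshold_alloc \<gamma> (j \<beta>) (\<xi> \<beta>) $ i))"
      unfolding inc
      using sum_segment_by_value[of "set_pmf P" bs t t'
          "\<lambda>\<beta>. \<beta> $ i * threshold_alloc \<gamma> (j \<beta>) (\<xi> \<beta>) $ i"] adm bs t
      by (simp add: admissible_def)
    have "0 \<le> bs ! s $ i * threshold_alloc \<gamma> (j (bs ! s)) (\<xi> (bs ! s)) $ i" if "s \<in> {t..<t'}" for s
    proof -
      have "bs ! s \<in> set_pmf P" using that t bs by (auto intro!: subsetD[OF bs(1)] nth_mem)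
      thus ?thesis
        using adm \<xi> birt_threshold_nonneg unfolding \<gamma>_def
        by (intro mult_nonneg_nonneg threshold_alloc_nonneg) (auto simp: admissible_def)
    qed
    hence "0 \<le> (\<Sum>s\<in>{t..<t'}. bs ! s $ i * threshold_alloc \<gamma> (j (bs ! s)) (\<xi> (bs ! s)) $ i)"
      by (rule sum_nonneg)
    thus "cum_utility \<pi> (take t bs) $ i \<le> cum_utility \<pi> (take t' bs) $ i"
      unfolding inc by simp
  qed (use j in auto)
qed

definition epoch_tolerance :: "real \<Rightarrow> real \<Rightarrow> nat \<Rightarrow> nat \<Rightarrow> real" where
  "epoch_tolerance \<eta> c T k = c * (birt_rem \<eta> T (Suc k))\<^sup>2 / birt_rem \<eta> T k"

text \<open>The complement of the count conditions in \<open>absorbs\<close>: all counts are over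
  the rest of the horizon, at either end of the epoch.\<close>

definition atypical :: "(real ^ 'n) pmf \<Rightarrow> real \<Rightarrow> real \<Rightarrow> nat \<Rightarrow> nat \<Rightarrow> (real ^ 'n) list set" where
  "atypical P \<eta> c T k =
     (\<Union>\<beta>\<in>set_pmf P. \<Union>t\<in>{birt_time \<eta> T k, birt_time \<eta> T (Suc k)}.
        {bs. epoch_tolerance \<eta> c T k
               < \<bar>real (count_list (drop t bs) \<beta>) - (real T - real t) * pmf P \<beta>\<bar>})"

lemma pathwise_regret:
  fixes P :: "(real ^ 'n::finite) pmf"
  assumes birt: "is_BIRT P \<eta> T \<pi>" and adm: "admissible P" and "1 < \<eta>" "3 \<le> T"
    and c: "absorbs P c" and bs: "set bs \<subseteq> set_pmf P" "length bs = T"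
  shows "hindsight_opt bs - alg_welfare \<pi> bs
         \<le> 3 + (\<Sum>k<birt_K \<eta> T. birt_rem \<eta> T k * indicator (atypical P \<eta> c T k) bs)"
proof -
  define S where "S = set_pmf P"
  define K where "K = birt_K \<eta> T"
  define tm where "tm = birt_time \<eta> T"
  define cost where "cost k = birt_rem \<eta> T k * indicator (atypical P \<eta> c T k) bs" for k
  have finS: "finite S" using adm by (simp add: admissible_def S_def)
  have tm_le: "tm k \<le> T" for k by (auto simp: tm_def birt_time_def)
  have tm_mono: "tm k \<le> tm (Suc k)" if "k \<le> K" for k
    using that birt_time_mono[OF assms(3,4), of k] tm_le[of K]
    by (cases "k = K") (auto simp: tm_def K_def birt_time_def)
  have total: "(\<Sum>\<beta>\<in>S. real (count_list (drop (tm k) bs) \<beta>)) = birt_rem \<eta> T k" for k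
  proof -
    have "set (drop (tm k) bs) \<subseteq> S" using bs set_drop_subset by (fastforce simp: S_def)
    hence "(\<Sum>\<beta>\<in>S. count_list (drop (tm k) bs) \<beta>) = length (drop (tm k) bs)"
      by (intro sum_count_set finS)
    thus ?thesis
      using tm_le[of k] bs by (simp add: birt_rem_def tm_def of_nat_diff flip: of_nat_sum)
  qed
  \<comment> \<open>Invariant: at the start of epoch \<open>k\<close>, the hindsight optimum less
    the costs so far is still attainable with the remaining arrivals.\<close>
  have plan: "\<exists>z. is_plan S (cum_utility \<pi> (take (tm k) bs))
      (\<lambda>\<beta>. real (count_list (drop (tm k) bs) \<beta>)) (hindsight_opt bs - (\<Sum>k'<k. cost k')) z"
    if "k \<le> K" for k
    using that
  proof (induction k)
    case 0
    have "tm 0 = 0" by (simp add: tm_def birt_time_def)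
    moreover have "cum_utility \<pi> [] = 0" by (simp add: cum_utility_def vec_eq_iff)
    ultimately show ?case using hindsight_plan[OF finS] bs by (simp add: S_def)
  next
    case (Suc k)
    define w where "w = hindsight_opt bs - (\<Sum>k'<k. cost k')"
    define N where "N k = (\<lambda>\<beta>. real (count_list (drop (tm k) bs) \<beta>))" for k
    define B where "B k = cum_utility \<pi> (take (tm k) bs)" for k
    obtain y where y: "is_plan S (B k) (N k) w y"
      using Suc unfolding w_def N_def B_def by auto
    have k: "k \<le> birt_K \<eta> T" "k < birt_K \<eta> T" "k \<le> K" using Suc.prems by (auto simp: K_def)
    obtain \<xi> j where epoch: "fluid_optimal P T (tm k) (B k) \<xi>"
      "\<And>\<beta>. \<beta> \<in> S \<Longrightarrow> is_arg_max (\<lambda>i. \<xi> \<beta> $ i) (\<lambda>_. True) (j \<beta>)"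
      "\<And>i. B (Suc k) $ i = B k $ i + (\<Sum>\<beta>\<in>S. (N k \<beta> - N (Suc k) \<beta>) *
          (\<beta> $ i * threshold_alloc (birt_threshold TYPE('n) \<eta> T k) (j \<beta>) (\<xi> \<beta>) $ i))"
      and mono: "\<And>i. B k $ i \<le> B (Suc k) $ i"
      using birt_epoch[OF birt adm k(1) bs tm_mono[OF k(3), unfolded tm_def]]
      unfolding S_def N_def B_def tm_def by blast
    have next_target: "hindsight_opt bs - (\<Sum>k'<Suc k. cost k') = w - cost k" by (simp add: w_def)
    show ?case
    proof (cases "bs \<in> atypical P \<eta> c T k")
      case True
      \<comment> \<open>After lowering the target by the number of periods left, the utilities
        already in hand reach it, so the zero plan suffices.\<close>
      have "w - birt_rem \<eta> T k \<le> B (Suc k) $ i" for i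
        using plan_target_le[OF adm y[unfolded S_def], of i] mono[of i] total[of k]
        unfolding S_def N_def by linarith
      hence "is_plan S (B (Suc k)) (N (Suc k)) (w - birt_rem \<eta> T k) (\<lambda>_ _. 0)"
        by (intro is_planI) (auto simp: N_def)
      thus ?thesis using True unfolding next_target by (auto simp: N_def B_def cost_def)
    next
      case False
      have "\<exists>z. is_plan S (B (Suc k)) (N (Suc k)) w z"
      proof (rule c[unfolded absorbs_def, rule_format, of "tm k" "tm (Suc k)" T "B k" \<xi> j _ "N (Suc k)" "N k" _ _ _ y, folded S_def])
        show "tm (Suc k) < T"
          using birt_time_no_trunc(2)[OF assms(3,4), of "Suc k"] k by (simp add: tm_def)
        show "birt_threshold TYPE('n) \<eta> T k =
            (real T - real (tm (Suc k))) / (2 * (real CARD('n))\<^sup>2 * (real T - real (tm k)))"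
          using k by (simp add: birt_threshold_def tm_def)
        show "N (Suc k) \<beta> \<le> N k \<beta>" for \<beta>
        proof -
          have "drop (tm (Suc k)) bs = drop (tm (Suc k) - tm k) (drop (tm k) bs)"
            using tm_mono[OF k(3)] by simp
          thus ?thesis
            unfolding N_def
            by (metis append_take_drop_id count_list_append le_add2 of_nat_le_iff)
        qed
        show "epoch_tolerance \<eta> c T k = c * (real T - real (tm (Suc k)))\<^sup>2 / (real T - real (tm k))"
          by (simp add: epoch_tolerance_def birt_rem_def tm_def)
      qed (use False epoch y tm_mono[OF k(3)] in \<open>auto simp: S_def N_def tm_def atypical_def not_less\<close>)
      thus ?thesis using False unfolding next_target by (simp add: N_def B_def cost_def)
    qed
  qed
  obtain z where "is_plan S (cum_utility \<pi> (take (tm K) bs))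
      (\<lambda>\<beta>. real (count_list (drop (tm K) bs) \<beta>)) (hindsight_opt bs - (\<Sum>k'<K. cost k')) z"
    using plan[OF order_refl] by blast
  note last = plan_target_le[OF adm this[unfolded S_def], folded S_def, unfolded total]
  \<comment> \<open>In the last epoch utilities only grow, and the arrivals left are worth at most
    3.\<close>
  have "hindsight_opt bs - (\<Sum>k<K. cost k) - 3 \<le> cum_utility \<pi> bs $ i" for i
  proof -
    have "tm (Suc K) = T" by (simp add: tm_def K_def birt_time_def)
    hence "cum_utility \<pi> (take (tm K) bs) $ i \<le> cum_utility \<pi> bs $ i"
      using birt_epoch[OF birt adm order_refl bs tm_mono[OF order_refl, unfolded tm_def K_def]] bs
      unfolding tm_def K_def by (metis order_refl take_all)
    thus ?thesis
      using last[of i] birt_rem_last[OF assms(3,4)] unfolding K_def by linarith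
  qed
  hence "hindsight_opt bs - (\<Sum>k<K. cost k) - 3 \<le> alg_welfare \<pi> bs"
    unfolding alg_welfare_def egal_welfare_def by (intro Min.boundedI) auto
  thus ?thesis by (simp add: cost_def K_def)
qed

text \<open>Union bound over the types and the two ends of the epoch. The later end has fewer
  periods remaining, so the Hoeffding bound of the earlier end covers both.\<close>

lemma prob_atypical:
  fixes P :: "(real ^ 'n::finite) pmf"
  assumes "admissible P" "1 < \<eta>" "3 \<le> T" "k < birt_K \<eta> T" "0 < c"
  shows "measure_pmf.prob (replicate_pmf T P) (atypical P \<eta> c T k)
    \<le> 4 * real (card (set_pmf P)) *
        exp (- 2 * (epoch_tolerance \<eta> c T k)\<^sup>2 / birt_rem \<eta> T k)"
proof -
  define \<delta> where "\<delta> = epoch_tolerance \<eta> c T k"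
  define e where "e = exp (- 2 * \<delta>\<^sup>2 / birt_rem \<eta> T k)"
  let ?t = "birt_time \<eta> T k" and ?t' = "birt_time \<eta> T (Suc k)"
  let ?A = "\<lambda>\<beta> t. {bs. \<delta> < \<bar>real (count_list (drop t bs) \<beta>) - (real T - real t) * pmf P \<beta>\<bar>}"
  let ?prob = "measure_pmf.prob (replicate_pmf T P)"
  have t: "?t \<le> ?t'" "?t' < T"
    using birt_time_mono[OF assms(2-4)] birt_time_no_trunc(2)[OF assms(2,3), of "Suc k"] assms(4)
    by auto
  have \<delta>: "0 \<le> \<delta>" using t assms(5) by (simp add: \<delta>_def epoch_tolerance_def birt_rem_def)
  have single: "?prob (?A \<beta> t) \<le> 2 * e" if "t \<in> {?t, ?t'}" for \<beta> t
  proof -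
    have "?prob (?A \<beta> t) \<le> 2 * exp (- 2 * \<delta>\<^sup>2 / (real T - real t))"
      using that t \<delta> by (intro prob_suffix_count_deviates) auto
    also have "2 * \<delta>\<^sup>2 / (real T - real ?t) \<le> 2 * \<delta>\<^sup>2 / (real T - real t)"
      using that t by (intro divide_left_mono mult_pos_pos) auto
    hence "2 * exp (- 2 * \<delta>\<^sup>2 / (real T - real t)) \<le> 2 * e"
      by (simp add: e_def birt_rem_def)
    finally show ?thesis .
  qed
  have "?prob (atypical P \<eta> c T k) \<le> (\<Sum>\<beta>\<in>set_pmf P. ?prob (\<Union>t\<in>{?t, ?t'}. ?A \<beta> t))"
    using assms(1) unfolding atypical_def \<delta>_def[symmetric]
    by (intro measure_pmf.finite_measure_subadditive_finite) (auto simp: admissible_def)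
  also have "\<dots> \<le> (\<Sum>\<beta>\<in>set_pmf P. 4 * e)"
  proof (intro sum_mono)
    fix \<beta> assume "\<beta> \<in> set_pmf P"
    have "?prob (\<Union>t\<in>{?t, ?t'}. ?A \<beta> t) = ?prob (?A \<beta> ?t \<union> ?A \<beta> ?t')" by simp
    also have "\<dots> \<le> ?prob (?A \<beta> ?t) + ?prob (?A \<beta> ?t')"
      by (intro measure_Un_le) auto
    also have "\<dots> \<le> 4 * e" using single[of ?t \<beta>] single[of ?t' \<beta>] by simp
    finally show "?prob (\<Union>t\<in>{?t, ?t'}. ?A \<beta> t) \<le> 4 * e" .
  qed
  finally show ?thesis by (simp add: e_def \<delta>_def mult_ac)
qed

theorem theorem2:
  fixes P :: "(real ^ 'n) pmf" and \<eta> :: real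
  assumes "admissible P"
    and "1 < \<eta>" and "\<eta> < 4 / 3"
  shows "\<exists>C. \<forall>T\<ge>3. \<forall>\<pi>. is_BIRT P \<eta> T \<pi> \<longrightarrow> regret P T \<pi> \<le> C"
proof -
  obtain c where c: "0 < c" "absorbs P c" using absorbs_exists[OF assms(1)] by blast
  define L where "L = 4 * real (card (set_pmf P))"
  \<comment> \<open>\<open>a m\<close> bounds, up to the factor \<open>L\<close>, the expected cost
    of the epoch with index \<open>m\<close> from the end. It does not involve \<open>T\<close>, so
    neither does the final constant.\<close>
  define a where "a m = exp (\<eta> ^ Suc m - c\<^sup>2 / 8 * exp ((4 - 3 * \<eta>) * \<eta> ^ m))" for m
  have a: "summable a"
    unfolding a_def using assms c by (intro summable_epoch_costs) auto
  show ?thesis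
  proof (intro exI[of _ "3 + L * suminf a"] allI impI)
    fix T \<pi> assume T: "3 \<le> T" and birt: "is_BIRT P \<eta> T \<pi>"
    define K where "K = birt_K \<eta> T"
    define M where "M = replicate_pmf T P"
    let ?G = "\<lambda>bs. 3 + (\<Sum>k<K. birt_rem \<eta> T k * indicator (atypical P \<eta> c T k) bs)"
    have setM: "set_pmf M = {bs \<in> lists (set_pmf P). length bs = T}"
      by (simp add: M_def set_replicate_pmf)
    have "finite (set_pmf M)"
    proof -
      have "set_pmf M = {bs. set bs \<subseteq> set_pmf P \<and> length bs = T}" unfolding setM by auto
      thus ?thesis using assms(1) by (simp add: admissible_def finite_lists_length_eq)
    qed
    hence int: "integrable M f" for f :: "_ \<Rightarrow> real" by (rule integrable_measure_pmf_finite)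
    have rem: "0 \<le> birt_rem \<eta> T k" for k by (auto simp: birt_rem_def birt_time_def)
    have "regret P T \<pi> \<le> measure_pmf.expectation M ?G"
      unfolding regret_def M_def[symmetric]
    proof (intro integral_mono_AE int AE_pmfI)
      fix bs assume "bs \<in> set_pmf M"
      thus "hindsight_opt bs - alg_welfare \<pi> bs \<le> ?G bs"
        using pathwise_regret[OF birt assms(1,2) T c(2), of bs] unfolding setM K_def by auto
    qed
    also have "\<dots> = measure_pmf.expectation M (\<lambda>_. 3) +
        (\<Sum>k<K. measure_pmf.expectation M
           (\<lambda>bs. birt_rem \<eta> T k * indicator (atypical P \<eta> c T k) bs))"
      by (subst Bochner_Integration.integral_add[OF int int],
          subst Bochner_Integration.integral_sum[OF int], rule refl)
    also have "\<dots> = 3 + (\<Sum>k<K. birt_rem \<eta> T k * measure_pmf.prob M (atypical P \<eta> c T k))"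
      by simp
    also have "\<dots> \<le> 3 + (\<Sum>k<K. L * a (K - Suc k))"
    proof (intro add_left_mono sum_mono)
      fix k assume "k \<in> {..<K}"
      hence k: "k < birt_K \<eta> T" by (simp add: K_def)
      have "birt_rem \<eta> T k * measure_pmf.prob M (atypical P \<eta> c T k)
          \<le> birt_rem \<eta> T k * (L * exp (- 2 * (epoch_tolerance \<eta> c T k)\<^sup>2 / birt_rem \<eta> T k))"
        unfolding M_def L_def
        using rem prob_atypical[OF assms(1,2) T k c(1)] by (intro mult_left_mono) auto
      also have "\<dots> = L * (birt_rem \<eta> T k * exp (- 2 * (epoch_tolerance \<eta> c T k)\<^sup>2 / birt_rem \<eta> T k))"
        by simp
      also have "\<dots> \<le> L * a (K - Suc k)"
        using epoch_failure_cost[OF assms(2) T k c(1)]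
        unfolding epoch_tolerance_def a_def K_def L_def by (intro mult_left_mono) auto
      finally show "birt_rem \<eta> T k * measure_pmf.prob M (atypical P \<eta> c T k) \<le> L * a (K - Suc k)" .
    qed
    \<comment> \<open>Counted backward, the epochs of every horizon give partial sums of the same
      series.\<close>
    also have "(\<Sum>k<K. L * a (K - Suc k)) = L * (\<Sum>m<K. a m)"
      by (simp add: sum.nat_diff_reindex sum_distrib_left[symmetric])
    also have "\<dots> \<le> L * suminf a"
    proof (intro mult_left_mono sum_le_suminf a)
      show "0 \<le> a m" for m by (simp add: a_def)
    qed (simp_all add: L_def)
    finally show "regret P T \<pi> \<le> 3 + L * suminf a" by simp
  qed
qed

end
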